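(* Let $k\ge3$ and $\beta\in\mathbb{R}$ with $|\beta|<1/(4\sqrt{k-1})$. Let $(G_N)$ be a sequence of $k$-regular graphs, $G_N$ having vertex set $[N]$ and girth $r(G_N)$, such that $r(G_N)/(\log\log N)^2\to\infty$ as $N\to\infty$. Let the edge weights $A_{ij}=A_{ji}$, $\{i,j\}\in E(G_N)$, be independent and uniformly distributed on $\{-\beta,\beta\}$, let $A_{ij}=0$ for $\{i,j\}\notin E(G_N)$, and let $\mathbf{h}_N=\mathbf{0}$. Then the Ising free energy density $F(G_N)$ of the resulting weighted graph $(\mathbf{A}_N,\mathbf{h}_N)$ satisfies, almost surely, $$\lim_{N\to\infty}F(G_N)=\log2+\frac{k}{2}\log\cosh(\beta).$$
   Context: For a symmetric matrix $\mathbf{A}\in\mathbb{R}^{N\times N}$ and $\mathbf{h}\in\mathbb{R}^N$, the Ising free energy density is $$F(\mathbf{A},\mathbf{h})=\frac1N\log\sum_{\boldsymbol\sigma\in\{-1,1\}^N}\exp\Big(\tfrac12\langle\boldsymbol\sigma,\mathbf{A}\boldsymbol\sigma\rangle+\langle\mathbf{h},\boldsymbol\sigma\rangle\Big).$$ The limit is taken along those $N$ for which $G_N$ is defined ($kN$ even). The graphs $G_N$ are deterministic; the only randomness is in the edge signs. *)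

theory Defs
  imports "HOL-Probability.Probability"
begin

text \<open>
  A simple graph on the vertex set \<open>{1..N}\<close> is given by its set of edges,
  each edge being a two-element set of vertices.
\<close>

definition simple_graph :: "nat \<Rightarrow> nat set set \<Rightarrow> bool" where
  "simple_graph N E \<longleftrightarrow> (\<forall>e\<in>E. e \<subseteq> {1..N} \<and> card e = 2)"

definition degree :: "nat set set \<Rightarrow> nat \<Rightarrow> nat" where
  "degree E v = card {e \<in> E. v \<in> e}"

definition regular_graph :: "nat \<Rightarrow> nat \<Rightarrow> nat set set \<Rightarrow> bool" where
  "regular_graph k N E \<longleftrightarrow> simple_graph N E \<and> (\<forall>v\<in>{1..N}. degree E v = k)"

text \<open>A cycle is the list of its vertices in order, the first one not being repeated at the end.\<close>

definition is_cycle :: "nat set set \<Rightarrow> nat list \<Rightarrow> bool" where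
  "is_cycle E vs \<longleftrightarrow> 3 \<le> length vs \<and> distinct vs \<and>
     (\<forall>i < length vs. {vs ! i, vs ! (Suc i mod length vs)} \<in> E)"

text \<open>The infimum is taken in \<open>enat\<close>, so that a forest has girth \<open>\<infinity>\<close>.\<close>

definition girth :: "nat set set \<Rightarrow> enat" where
  "girth E = (INF vs \<in> {vs. is_cycle E vs}. enat (length vs))"

definition ising_free_energy :: "nat \<Rightarrow> (nat \<Rightarrow> nat \<Rightarrow> real) \<Rightarrow> (nat \<Rightarrow> real) \<Rightarrow> real" where
  "ising_free_energy N A h =
     1 / real N * ln (\<Sum>\<sigma> \<in> {1..N} \<rightarrow>\<^sub>E {-1, 1}.
       exp (1 / 2 * (\<Sum>i\<in>{1..N}. \<sigma> i * (\<Sum>j\<in>{1..N}. A i j * \<sigma> j)) + (\<Sum>i\<in>{1..N}. h i * \<sigma> i)))"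

text \<open>
  The law is compared on the Borel sets of the reals. For \<open>\<beta> = 0\<close> the set
  \<open>{-\<beta>, \<beta>}\<close> is a singleton and the law is the point mass at 0.
\<close>

definition uniform_signs :: "'a measure \<Rightarrow> real \<Rightarrow> ('a \<Rightarrow> real) \<Rightarrow> bool" where
  "uniform_signs M \<beta> X \<longleftrightarrow> X \<in> borel_measurable M \<and>
     distr M borel X = distr (measure_pmf (pmf_of_set {-\<beta>, \<beta>})) borel (\<lambda>x. x)"

text \<open>
  Since the weights are symmetric, each edge \<open>{i, j}\<close> is represented by its
  ordered pair with \<open>i < j\<close> in the family of independent variables.
\<close>

definition random_sign_weights ::
  "'a measure \<Rightarrow> real \<Rightarrow> nat \<Rightarrow> nat set set \<Rightarrow> (nat \<Rightarrow> nat \<Rightarrow> 'a \<Rightarrow> real) \<Rightarrow> bool" where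
  "random_sign_weights M \<beta> N E A \<longleftrightarrow>
     (\<forall>i\<in>{1..N}. \<forall>j\<in>{1..N}. \<forall>\<omega>\<in>space M. A i j \<omega> = A j i \<omega>) \<and>
     (\<forall>i\<in>{1..N}. \<forall>j\<in>{1..N}. {i, j} \<notin> E \<longrightarrow> (\<forall>\<omega>\<in>space M. A i j \<omega> = 0)) \<and>
     (\<forall>i\<in>{1..N}. \<forall>j\<in>{1..N}. {i, j} \<in> E \<longrightarrow> uniform_signs M \<beta> (A i j)) \<and>
     prob_space.indep_vars M (\<lambda>_. borel) (\<lambda>(i, j). A i j) {(i, j). i < j \<and> {i, j} \<in> E}"

text \<open>
  The values of \<open>N\<close> for which a \<open>k\<close>-regular simple graph on \<open>{1..N}\<close> with \<open>N > 0\<close> exists;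
  the condition \<open>k < N\<close> only discards finitely many \<open>N\<close>.
\<close>

definition admissible_sizes :: "nat \<Rightarrow> nat set" where
  "admissible_sizes k = {N. k < N \<and> even (k * N)}"

definition along_admissible :: "nat \<Rightarrow> nat filter" where
  "along_admissible k = inf sequentially (principal (admissible_sizes k))"

end

theory Submission
  imports Defs "HOL-Real_Asymp.Real_Asymp"
begin

text \<open>
  Write \<open>E\<close> for the edge set of \<open>G\<^sub>N\<close>, \<open>m = k N / 2\<close> for its size, \<open>t = tanh \<beta>\<close>, and
  \<open>A\<^sub>e = \<beta> s\<^sub>e\<close> with independent uniform signs \<open>s\<^sub>e\<close>. For \<open>b = 1\<close> and \<open>b = -1\<close> one has
  \<open>exp (\<beta> b) = cosh \<beta> (1 + t b)\<close>, hence the partition function equals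
  \<open>2\<^sup>N (cosh \<beta>)\<^sup>m W(s)\<close>, where \<open>W(s)\<close> is the mean over the spins \<open>\<sigma>\<close> of the product over the
  edges of \<open>1 + t s\<^sub>e \<sigma>\<^sub>e\<close>, and \<open>\<sigma>\<^sub>e\<close> is the product of the two spins on \<open>e\<close>
  (\<open>ising_free_energy_signs\<close>). The prefactor is the claimed limit, so it has to be shown that
  \<open>ln W / N\<close> tends to 0 almost surely.

  Expanding the product, \<open>W\<close> has mean 1, and its second moment is the sum of \<open>t\<close> to the power
  \<open>2|H|\<close> over the subgraphs \<open>H\<close> all of whose degrees are even (\<open>second_moment\<close>). Such a
  subgraph is a disjoint union of cycles, which bounds the second moment by the exponential of
  the sum of \<open>t\<close> to the power \<open>2|C|\<close> over all cycles \<open>C\<close> (\<open>sum_even_subgraphs_le\<close>). There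
  are at most \<open>N k\<^sup>l\<close> cycles of length \<open>l\<close>, none of them shorter than the girth, and
  \<open>t\<^sup>2 k\<close> is at most \<open>1/2\<close>; as the girth tends to infinity, the second moment is
  \<open>exp (o(N))\<close> (\<open>sum_cycles_le\<close>).

  The second moment method then gives \<open>W \<ge> 1/2\<close> only with probability at least
  \<open>exp (-o(N))\<close>. However, flipping one sign changes \<open>ln W\<close> by at most 2, so that \<open>ln W\<close> lies
  within \<open>\<eta> N\<close> of its mean up to probability \<open>exp (-c N)\<close> with \<open>c > 0\<close> depending on \<open>\<eta>\<close>
  (\<open>concentration_signs\<close>). The two events must meet, which locates the mean above
  \<open>- ln 2 - \<eta> N\<close>, and concentration makes the lower bound hold up to probability
  \<open>exp (-c N)\<close>. The upper bound is Markov's inequality for \<open>W\<close> (\<open>log_deviation_signs\<close>).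
  These error probabilities are summable in \<open>N\<close>, and the Borel-Cantelli lemma concludes.
\<close>

section \<open>Concentration on the discrete cube\<close>

abbreviation signs :: "'i set \<Rightarrow> ('i \<Rightarrow> real) set" where
  "signs I \<equiv> I \<rightarrow>\<^sub>E {-1, 1}"

lemma finite_signs [simp]: "finite I \<Longrightarrow> finite (signs I)"
  by (intro finite_PiE) auto

lemma card_signs: "finite I \<Longrightarrow> card (signs I) = 2 ^ card I"
  by (subst card_funcsetE) (auto simp: numeral_2_eq_2)

lemma sum_prod_signs:
  fixes g :: "'i \<Rightarrow> real \<Rightarrow> real"
  assumes "finite I"
  shows "(\<Sum>s\<in>signs I. \<Prod>i\<in>I. g i (s i)) = (\<Prod>i\<in>I. g i (-1) + g i 1)"
  using prod_sum_PiE[of I "\<lambda>_. {-1, 1}" g] assms by simp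

lemma sum_signs_insert:
  fixes f :: "('i \<Rightarrow> real) \<Rightarrow> real"
  assumes "finite I" "i \<notin> I"
  shows "(\<Sum>s\<in>signs (insert i I). f s) = (\<Sum>s\<in>signs I. f (s(i := 1)) + f (s(i := -1)))"
proof -
  have "(\<Sum>s\<in>signs (insert i I). f s) = (\<Sum>p\<in>{-1, 1} \<times> signs I. f ((snd p)(i := fst p)))"
    unfolding PiE_insert_eq
    by (subst sum.reindex)
       (use inj_combinator[OF assms(2), of "\<lambda>_. {-1, 1}"] in \<open>auto simp: case_prod_beta\<close>)
  also have "\<dots> = (\<Sum>b\<in>{-1, 1}. \<Sum>s\<in>signs I. f (s(i := b)))"
    by (subst sum.cartesian_product) (simp add: case_prod_beta)
  finally show ?thesis
    by (simp add: sum.distrib)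
qed

lemma fun_upd_signs: "s \<in> signs I \<Longrightarrow> b \<in> {-1, 1} \<Longrightarrow> s(i := b) \<in> signs (insert i I)"
  by (auto simp: PiE_iff extensional_def)

text \<open>
  This is Hoeffding's lemma for a fair sign.
\<close>
lemma cosh_le_exp_half_square: "cosh x \<le> exp (x\<^sup>2 / 2)" for x :: real
proof -
  have "cosh x = exp (ln (cosh \<bar>x\<bar>))"
    by (simp add: cosh_real_pos)
  also have "cosh \<bar>x\<bar> = exp (-\<bar>x\<bar>) * (1 + 1/2 * (exp (2 * \<bar>x\<bar>) - 1))"
    by (simp add: cosh_def field_simps flip: exp_add)
  also have "ln \<dots> = - (2 * \<bar>x\<bar>) * (1/2) + ln (1 + 1/2 * (exp (2 * \<bar>x\<bar>) - 1))"
    by (subst ln_mult_pos) (auto intro: add_pos_nonneg)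
  also have "\<dots> \<le> (2 * \<bar>x\<bar>)\<^sup>2 / 8"
    by (rule Hoeffdings_lemma_aux) auto
  finally show ?thesis by (simp add: power2_eq_square)
qed

text \<open>
  Averaging over one coordinate leaves a function on the smaller cube that satisfies the same
  flip condition, and costs a factor \<open>cosh (l d)\<close> with \<open>|d| \<le> a\<close>. This is the martingale
  argument for bounded differences, unrolled into an induction on the index set.
\<close>
lemma exponential_moment_signs:
  fixes f :: "('i \<Rightarrow> real) \<Rightarrow> real" and a :: real
  assumes "finite I"
    and "\<And>s i. s \<in> signs I \<Longrightarrow> i \<in> I \<Longrightarrow> \<bar>f (s(i := 1)) - f (s(i := -1))\<bar> \<le> 2 * a"
  shows "(\<Sum>s\<in>signs I. exp (l * f s))
    \<le> 2 ^ card I * exp (l * ((\<Sum>s\<in>signs I. f s) / 2 ^ card I) + l\<^sup>2 * a\<^sup>2 * card I / 2)"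
  using assms
proof (induction I arbitrary: f rule: finite_induct)
  case empty
  then show ?case by simp
next
  case (insert i I)
  define g where "g s = (f (s(i := 1)) + f (s(i := -1))) / 2" for s
  define d where "d s = (f (s(i := 1)) - f (s(i := -1))) / 2" for s
  have gd: "f (s(i := 1)) = g s + d s" "f (s(i := -1)) = g s - d s" for s
    by (auto simp: g_def d_def field_simps)
  have g_flip: "\<bar>g (s(j := 1)) - g (s(j := -1))\<bar> \<le> 2 * a" if s: "s \<in> signs I" and j: "j \<in> I" for s j
  proof -
    have "i \<noteq> j" using insert.hyps j by auto
    then have comm: "s(j := b, i := c) = s(i := c, j := b)" for b c
      by (rule fun_upd_twist[symmetric])
    have "\<bar>f ((s(i := c))(j := 1)) - f ((s(i := c))(j := -1))\<bar> \<le> 2 * a" if "c \<in> {-1, 1}" for c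
      by (rule insert.prems[OF fun_upd_signs[OF s that] insertI2[OF j]])
    from this[of 1] this[of "-1"] show ?thesis
      unfolding g_def comm by (simp add: field_simps abs_le_iff)
  qed
  have d: "(d s)\<^sup>2 \<le> a\<^sup>2" if s: "s \<in> signs I" for s
  proof -
    have "\<bar>f ((s(i := 1))(i := 1)) - f ((s(i := 1))(i := -1))\<bar> \<le> 2 * a"
      by (rule insert.prems[OF fun_upd_signs[OF s] insertI1]) simp
    then have "\<bar>d s\<bar> \<le> a" by (simp add: d_def)
    then show ?thesis by (metis abs_ge_zero power2_abs power_mono)
  qed
  have mean: "(\<Sum>s\<in>signs (insert i I). f s) / 2 ^ card (insert i I) = (\<Sum>s\<in>signs I. g s) / 2 ^ card I"
    using insert.hyps by (simp add: sum_signs_insert g_def sum_divide_distrib[symmetric])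
  have "(\<Sum>s\<in>signs (insert i I). exp (l * f s)) = (\<Sum>s\<in>signs I. 2 * (exp (l * g s) * cosh (l * d s)))"
    unfolding sum_signs_insert[OF insert.hyps(1,2)] gd
    by (intro sum.cong refl) (simp add: cosh_def algebra_simps flip: exp_add)
  also have "\<dots> \<le> (\<Sum>s\<in>signs I. 2 * (exp (l * g s) * exp (l\<^sup>2 * a\<^sup>2 / 2)))"
  proof (intro sum_mono mult_left_mono)
    fix s assume "s \<in> signs I"
    have "cosh (l * d s) \<le> exp ((l * d s)\<^sup>2 / 2)" by (rule cosh_le_exp_half_square)
    also have "\<dots> \<le> exp (l\<^sup>2 * a\<^sup>2 / 2)"
      using d[OF \<open>s \<in> signs I\<close>] by (simp add: power_mult_distrib mult_left_mono)
    finally show "cosh (l * d s) \<le> exp (l\<^sup>2 * a\<^sup>2 / 2)" .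
  qed auto
  also have "\<dots> = 2 * exp (l\<^sup>2 * a\<^sup>2 / 2) * (\<Sum>s\<in>signs I. exp (l * g s))"
    by (simp add: sum_distrib_left sum_distrib_right mult_ac)
  also have "\<dots> \<le> 2 * exp (l\<^sup>2 * a\<^sup>2 / 2) *
      (2 ^ card I * exp (l * ((\<Sum>s\<in>signs I. g s) / 2 ^ card I) + l\<^sup>2 * a\<^sup>2 * card I / 2))"
    by (intro mult_left_mono insert.IH g_flip) auto
  also have "\<dots> = 2 ^ card (insert i I) *
      exp (l * ((\<Sum>s\<in>signs I. g s) / 2 ^ card I) + l\<^sup>2 * a\<^sup>2 * card (insert i I) / 2)"
    using insert.hyps by (simp add: add_divide_distrib distrib_left exp_add)
  finally show ?case unfolding mean .
qed

text \<open>
  Chernoff's bound at the optimal parameter \<open>l = r / (a\<^sup>2 |I|)\<close>.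
\<close>
lemma concentration_signs:
  fixes f :: "('i \<Rightarrow> real) \<Rightarrow> real" and a :: real
  assumes "finite I" "I \<noteq> {}" "0 < a" "0 \<le> r"
    and "\<And>s i. s \<in> signs I \<Longrightarrow> i \<in> I \<Longrightarrow> \<bar>f (s(i := 1)) - f (s(i := -1))\<bar> \<le> 2 * a"
  shows "card {s \<in> signs I. (\<Sum>s\<in>signs I. f s) / 2 ^ card I + r \<le> f s}
    \<le> 2 ^ card I * exp (- r\<^sup>2 / (2 * a\<^sup>2 * card I))"
proof -
  let ?mu = "(\<Sum>s\<in>signs I. f s) / 2 ^ card I"
  let ?B = "{s \<in> signs I. ?mu + r \<le> f s}"
  define l where "l = r / (a\<^sup>2 * card I)"
  have m: "real (card I) > 0" using assms(1,2) by (simp add: card_gt_0_iff)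
  have "real (card ?B) * exp (l * (?mu + r)) = (\<Sum>s\<in>?B. exp (l * (?mu + r)))" by simp
  also have "\<dots> \<le> (\<Sum>s\<in>?B. exp (l * f s))"
    using assms m by (intro sum_mono) (auto simp: l_def intro!: divide_right_mono mult_left_mono)
  also have "\<dots> \<le> (\<Sum>s\<in>signs I. exp (l * f s))"
    using assms(1) by (intro sum_mono2) auto
  also have "\<dots> \<le> 2 ^ card I * exp (l * ?mu + l\<^sup>2 * a\<^sup>2 * card I / 2)"
    by (rule exponential_moment_signs) (use assms in auto)
  finally have "real (card ?B) \<le> 2 ^ card I * (exp (l * ?mu + l\<^sup>2 * a\<^sup>2 * card I / 2) / exp (l * (?mu + r)))"
    by (simp add: field_simps)
  also have "exp (l * ?mu + l\<^sup>2 * a\<^sup>2 * card I / 2) / exp (l * (?mu + r))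
      = exp (- r\<^sup>2 / (2 * a\<^sup>2 * card I))"
    using m assms(3) unfolding l_def exp_diff[symmetric]
    by (intro arg_cong[where f = exp]) (simp add: field_simps power2_eq_square)
  finally show ?thesis .
qed

text \<open>
  A second moment of size \<open>B\<close> yields \<open>W \<ge> 1/2\<close> on a set \<open>K\<close> of density at least
  \<open>1/(4 B)\<close> (Paley-Zygmund). The last assumption says that the set where \<open>ln W\<close> exceeds its
  mean \<open>mu\<close> by \<open>r\<close> has smaller density than that, so some point of \<open>K\<close> lies outside it and
  \<open>mu > - ln 2 - r\<close>. Concentration below \<open>mu\<close> therefore amplifies the weak lower bound on
  \<open>W\<close> from a set of tiny density to almost the whole cube.
\<close>
lemma log_deviation_signs:
  fixes W :: "('i \<Rightarrow> real) \<Rightarrow> real"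
  assumes I: "finite I" "I \<noteq> {}" and r: "0 \<le> r"
    and pos: "\<And>s. s \<in> signs I \<Longrightarrow> 0 < W s"
    and mean: "(\<Sum>s\<in>signs I. W s) = 2 ^ card I"
    and square: "(\<Sum>s\<in>signs I. (W s)\<^sup>2) \<le> 2 ^ card I * B"
    and flip: "\<And>s i. s \<in> signs I \<Longrightarrow> i \<in> I \<Longrightarrow> \<bar>ln (W (s(i := 1))) - ln (W (s(i := -1)))\<bar> \<le> 2"
    and small: "exp (- r\<^sup>2 / (2 * card I)) * (4 * B) < 1"
  shows "card {s \<in> signs I. r \<le> ln (W s) \<or> ln (W s) \<le> - ln 2 - 2 * r}
    \<le> 2 ^ card I * (exp (- r) + exp (- r\<^sup>2 / (2 * card I)))"
proof -
  let ?S = "signs I" and ?M = "2 ^ card I :: real" and ?d = "exp (- r\<^sup>2 / (2 * card I))"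
  define mu where "mu = (\<Sum>s\<in>?S. ln (W s)) / ?M"
  define U where "U = {s \<in> ?S. mu + r \<le> ln (W s)}"
  define L where "L = {s \<in> ?S. - mu + r \<le> - ln (W s)}"
  define T where "T = {s \<in> ?S. r \<le> ln (W s)}"
  define K where "K = {s \<in> ?S. 1 / 2 \<le> W s}"
  have fin: "finite ?S" using I by simp
  have U: "card U \<le> ?M * ?d"
    using concentration_signs[of I 1 r "\<lambda>s. ln (W s)"] I r flip by (simp add: U_def mu_def)
  have L: "card L \<le> ?M * ?d"
    using concentration_signs[of I 1 r "\<lambda>s. - ln (W s)"] I r flip
    by (simp add: L_def mu_def sum_negf abs_minus_commute)
  have T: "card T \<le> ?M * exp (- r)"
  proof -
    have "real (card T) * exp r = (\<Sum>s\<in>T. exp r)" by simp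
    also have "\<dots> \<le> (\<Sum>s\<in>T. W s)"
      using pos by (intro sum_mono) (auto simp: T_def ln_ge_iff)
    also have "\<dots> \<le> (\<Sum>s\<in>?S. W s)"
      using fin pos by (intro sum_mono2) (auto simp: T_def less_imp_le)
    finally show ?thesis using mean by (simp add: exp_minus field_simps)
  qed
  have K: "?M \<le> 4 * B * card K"
  proof -
    have "?M = (\<Sum>s\<in>K. W s) + (\<Sum>s\<in>?S - K. W s)"
      using fin by (subst mean[symmetric], subst sum.subset_diff[of K]) (auto simp: K_def)
    also have "(\<Sum>s\<in>?S - K. W s) \<le> (\<Sum>s\<in>?S - K. 1 / 2)"
      by (intro sum_mono) (auto simp: K_def)
    also have "\<dots> \<le> (\<Sum>s\<in>?S. 1 / 2)" using fin by (intro sum_mono2) auto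
    also have "\<dots> = ?M / 2" using I by (simp add: card_signs)
    finally have "?M / 2 \<le> (\<Sum>s\<in>K. W s)" by simp
    then have "(?M / 2)\<^sup>2 \<le> (\<Sum>s\<in>K. W s * 1)\<^sup>2" by (intro power_mono) auto
    also have "\<dots> \<le> (\<Sum>s\<in>K. (W s)\<^sup>2) * (\<Sum>s\<in>K. 1\<^sup>2)" by (rule Cauchy_Schwarz_ineq_sum)
    also have "\<dots> \<le> (\<Sum>s\<in>?S. (W s)\<^sup>2) * card K"
      using fin by (auto intro!: mult_right_mono sum_mono2 simp: K_def)
    also have "\<dots> \<le> ?M * B * card K" using square by (intro mult_right_mono) auto
    finally have "?M * ?M \<le> ?M * (4 * B * card K)" by (simp add: power2_eq_square)
    then show ?thesis by simp
  qed
  have "\<not> K \<subseteq> U"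
  proof
    assume "K \<subseteq> U"
    then have le: "real (card K) \<le> ?M * ?d"
      using U card_mono[of U K] fin by (fastforce simp: U_def)
    have "0 < 4 * B * card K" using K by (rule less_le_trans[rotated]) simp
    then have "0 < B" by (auto simp: zero_less_mult_iff)
    then have "4 * B * card K \<le> 4 * B * (?M * ?d)" using le by (intro mult_left_mono) auto
    also have "\<dots> = ?M * (?d * (4 * B))" by simp
    also have "\<dots> < ?M * 1" using small by (intro mult_strict_left_mono) auto
    finally show False using K by simp
  qed
  then obtain s where "s \<in> K" "s \<notin> U" by blast
  then have s: "s \<in> ?S" "1 / 2 \<le> W s" "ln (W s) < mu + r" by (auto simp: K_def U_def)
  have "- ln 2 = ln (1 / 2 :: real)" by (simp add: ln_div)
  also have "\<dots> \<le> ln (W s)" using s pos by (subst ln_le_cancel_iff) auto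
  finally have mu: "- ln 2 - r < mu" using s by linarith
  have "{s \<in> ?S. r \<le> ln (W s) \<or> ln (W s) \<le> - ln 2 - 2 * r} \<subseteq> T \<union> L"
    using mu by (auto simp: T_def L_def)
  then have "card {s \<in> ?S. r \<le> ln (W s) \<or> ln (W s) \<le> - ln 2 - 2 * r} \<le> card (T \<union> L)"
    using fin by (intro card_mono) (auto simp: T_def L_def)
  also have "\<dots> \<le> card T + card L" by (rule card_Un_le)
  finally show ?thesis using T L by (simp add: distrib_left)
qed

section \<open>Moments of the reduced partition function\<close>

abbreviation spin_product :: "(nat \<Rightarrow> real) \<Rightarrow> nat set \<Rightarrow> real" where
  "spin_product \<sigma> e \<equiv> (\<Prod>v\<in>e. \<sigma> v)"

definition even_subgraphs :: "nat set set \<Rightarrow> nat set set set" where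
  "even_subgraphs E = {H. H \<subseteq> E \<and> (\<forall>v. even (degree H v))}"

text \<open>
  The partition function with signs \<open>s\<close>, normalised to have mean 1 over uniform signs, for
  \<open>t = tanh \<beta>\<close>.
\<close>
definition reduced_partition :: "nat \<Rightarrow> nat set set \<Rightarrow> real \<Rightarrow> (nat set \<Rightarrow> real) \<Rightarrow> real" where
  "reduced_partition N E t s =
     (\<Sum>\<sigma>\<in>signs {1..N}. \<Prod>e\<in>E. 1 + t * s e * spin_product \<sigma> e) / 2 ^ N"

lemma simple_graph_finite: "simple_graph N E \<Longrightarrow> finite E"
  unfolding simple_graph_def by (rule finite_subset[of _ "Pow {1..N}"]) auto

lemma spin_product_sign:
  assumes "simple_graph N E" "\<sigma> \<in> signs {1..N}" "e \<in> E"
  shows "spin_product \<sigma> e \<in> {-1, 1}"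
proof -
  have "finite e" "\<forall>v\<in>e. \<sigma> v \<in> {-1, 1}"
    using assms by (auto simp: simple_graph_def PiE_iff dest: finite_subset)
  then show ?thesis by (induction e rule: finite_induct) auto
qed

text \<open>
  The monomial of \<open>H\<close> contains the spin at \<open>v\<close> to the power of the degree of \<open>v\<close>; an odd
  degree lets the two values of that spin cancel.
\<close>
lemma sum_spin_monomial:
  assumes E: "simple_graph N E" and H: "H \<subseteq> E"
  shows "(\<Sum>\<sigma>\<in>signs {1..N}. \<Prod>e\<in>H. spin_product \<sigma> e) = (if H \<in> even_subgraphs E then 2 ^ N else 0)"
proof -
  have fin: "finite H" using simple_graph_finite[OF E] H by (rule rev_finite_subset)
  have sub: "e \<subseteq> {1..N}" if "e \<in> H" for e using that E H by (auto simp: simple_graph_def)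
  have "(\<Prod>e\<in>H. spin_product \<sigma> e) = (\<Prod>v\<in>{1..N}. \<sigma> v ^ degree H v)" for \<sigma> :: "nat \<Rightarrow> real"
  proof -
    have "(\<Prod>e\<in>H. spin_product \<sigma> e) = (\<Prod>e\<in>H. \<Prod>v\<in>{1..N}. if v \<in> e then \<sigma> v else 1)"
    proof (rule prod.cong[OF refl])
      fix e assume "e \<in> H"
      then have "{1..N} \<inter> {v. v \<in> e} = e" using sub by auto
      then show "spin_product \<sigma> e = (\<Prod>v\<in>{1..N}. if v \<in> e then \<sigma> v else 1)"
        by (subst prod.If_cases) auto
    qed
    also have "\<dots> = (\<Prod>v\<in>{1..N}. \<Prod>e\<in>H. if v \<in> e then \<sigma> v else 1)" by (rule prod.swap)
    also have "\<dots> = (\<Prod>v\<in>{1..N}. \<sigma> v ^ degree H v)"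
      using fin by (simp add: prod.If_cases degree_def Int_def)
    finally show ?thesis .
  qed
  then have eq: "(\<Sum>\<sigma>\<in>signs {1..N}. \<Prod>e\<in>H. spin_product \<sigma> e)
      = (\<Prod>v\<in>{1..N}. (-1) ^ degree H v + 1 ^ degree H v :: real)"
    by (simp only: sum_prod_signs[of "{1..N}" "\<lambda>v x. x ^ degree H v"] finite_atLeastAtMost)
  show ?thesis
  proof (cases "H \<in> even_subgraphs E")
    case True
    then show ?thesis unfolding eq by (simp add: even_subgraphs_def)
  next
    case False
    then obtain v where v: "odd (degree H v)" using H by (auto simp: even_subgraphs_def)
    then have "degree H v \<noteq> 0" by (metis even_zero)
    then have "{e \<in> H. v \<in> e} \<noteq> {}" by (metis card.empty degree_def)
    then have "v \<in> {1..N}" using sub by blast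
    then have "(\<Prod>v\<in>{1..N}. (-1) ^ degree H v + 1 ^ degree H v :: real) = 0"
      using v by (intro prod_zero) (auto intro!: bexI[of _ v])
    then show ?thesis using False eq by simp
  qed
qed

lemma first_moment:
  assumes E: "simple_graph N E"
  shows "(\<Sum>s\<in>signs E. reduced_partition N E t s) = 2 ^ card E"
proof -
  have fin: "finite E" using E by (rule simple_graph_finite)
  have "(\<Sum>s\<in>signs E. reduced_partition N E t s)
      = (\<Sum>\<sigma>\<in>signs {1..N}. \<Sum>s\<in>signs E. \<Prod>e\<in>E. 1 + t * s e * spin_product \<sigma> e) / 2 ^ N"
    unfolding reduced_partition_def sum_divide_distrib[symmetric] by (subst sum.swap) simp
  also have "\<dots> = (\<Sum>\<sigma>\<in>signs {1..N}. 2 ^ card E) / 2 ^ N"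
    using sum_prod_signs[OF fin, of "\<lambda>e x. 1 + t * x * spin_product _ e"] by simp
  also have "\<dots> = 2 ^ card E" by (simp add: card_signs)
  finally show ?thesis .
qed

lemma sum_rotate:
  "(\<Sum>a\<in>A. \<Sum>b\<in>B. \<Sum>c\<in>C. f a b c) = (\<Sum>c\<in>C. \<Sum>a\<in>A. \<Sum>b\<in>B. f a b c)"
proof -
  have "(\<Sum>a\<in>A. \<Sum>b\<in>B. \<Sum>c\<in>C. f a b c) = (\<Sum>a\<in>A. \<Sum>c\<in>C. \<Sum>b\<in>B. f a b c)"
    by (intro sum.cong refl sum.swap)
  also have "\<dots> = (\<Sum>c\<in>C. \<Sum>a\<in>A. \<Sum>b\<in>B. f a b c)" by (rule sum.swap)
  finally show ?thesis .
qed

text \<open>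
  For two replicas \<open>\<sigma>\<close>, \<open>\<tau>\<close> the average over the sign of an edge is
  \<open>1 + t\<^sup>2 \<sigma>\<^sub>e \<tau>\<^sub>e\<close>. After expansion the two replicas separate, and each subgraph contributes
  the square of its spin average, which is 1 or 0.
\<close>
lemma second_moment:
  assumes E: "simple_graph N E"
  shows "(\<Sum>s\<in>signs E. (reduced_partition N E t s)\<^sup>2)
    = 2 ^ card E * (\<Sum>H\<in>even_subgraphs E. (t\<^sup>2) ^ card H)"
proof -
  have fin: "finite E" using E by (rule simple_graph_finite)
  let ?S = "signs {1..N}"
  let ?w = "\<lambda>s \<sigma> e. 1 + t * s * spin_product \<sigma> e"
  have "(\<Sum>s\<in>signs E. (reduced_partition N E t s)\<^sup>2)
      = (\<Sum>s\<in>signs E. \<Sum>\<sigma>\<in>?S. \<Sum>\<tau>\<in>?S. \<Prod>e\<in>E. ?w (s e) \<sigma> e * ?w (s e) \<tau> e) / 4 ^ N"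
    by (simp add: reduced_partition_def power_divide power2_eq_square sum_product prod.distrib
        sum_divide_distrib[symmetric] flip: power_mult_distrib)
  also have "(\<Sum>s\<in>signs E. \<Sum>\<sigma>\<in>?S. \<Sum>\<tau>\<in>?S. \<Prod>e\<in>E. ?w (s e) \<sigma> e * ?w (s e) \<tau> e)
      = (\<Sum>\<sigma>\<in>?S. \<Sum>\<tau>\<in>?S. \<Sum>s\<in>signs E. \<Prod>e\<in>E. ?w (s e) \<sigma> e * ?w (s e) \<tau> e)"
    by (rule sum_rotate[symmetric])
  also have "\<dots> = (\<Sum>\<sigma>\<in>?S. \<Sum>\<tau>\<in>?S. 2 ^ card E *
      (\<Prod>e\<in>E. t\<^sup>2 * (spin_product \<sigma> e * spin_product \<tau> e) + 1))"
  proof (intro sum.cong refl)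
    fix \<sigma> \<tau> :: "nat \<Rightarrow> real"
    have "(\<Sum>s\<in>signs E. \<Prod>e\<in>E. ?w (s e) \<sigma> e * ?w (s e) \<tau> e)
        = (\<Prod>e\<in>E. ?w (-1) \<sigma> e * ?w (-1) \<tau> e + ?w 1 \<sigma> e * ?w 1 \<tau> e)"
      by (rule sum_prod_signs[OF fin, of "\<lambda>e x. ?w x \<sigma> e * ?w x \<tau> e"])
    also have "\<dots> = (\<Prod>e\<in>E. 2 * (t\<^sup>2 * (spin_product \<sigma> e * spin_product \<tau> e) + 1))"
      by (rule prod.cong) (auto simp: algebra_simps power2_eq_square)
    finally show "(\<Sum>s\<in>signs E. \<Prod>e\<in>E. ?w (s e) \<sigma> e * ?w (s e) \<tau> e) = 2 ^ card E *
        (\<Prod>e\<in>E. t\<^sup>2 * (spin_product \<sigma> e * spin_product \<tau> e) + 1)"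
      by (simp only: prod.distrib prod_constant)
  qed
  also have "\<dots> = 2 ^ card E * (\<Sum>\<sigma>\<in>?S. \<Sum>\<tau>\<in>?S. \<Sum>H\<in>Pow E. (t\<^sup>2) ^ card H *
      ((\<Prod>e\<in>H. spin_product \<sigma> e) * (\<Prod>e\<in>H. spin_product \<tau> e)))"
    by (simp add: prod_add[OF fin] prod.distrib sum_distrib_left)
  also have "(\<Sum>\<sigma>\<in>?S. \<Sum>\<tau>\<in>?S. \<Sum>H\<in>Pow E. (t\<^sup>2) ^ card H *
        ((\<Prod>e\<in>H. spin_product \<sigma> e) * (\<Prod>e\<in>H. spin_product \<tau> e)))
      = (\<Sum>H\<in>Pow E. \<Sum>\<sigma>\<in>?S. \<Sum>\<tau>\<in>?S. (t\<^sup>2) ^ card H *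
        ((\<Prod>e\<in>H. spin_product \<sigma> e) * (\<Prod>e\<in>H. spin_product \<tau> e)))"
    by (rule sum_rotate)
  also have "\<dots> = (\<Sum>H\<in>Pow E. (t\<^sup>2) ^ card H * (\<Sum>\<sigma>\<in>?S. \<Prod>e\<in>H. spin_product \<sigma> e)\<^sup>2)"
    by (simp only: power2_eq_square[of "sum _ _"] sum_product) (simp only: sum_distrib_left)
  also have "\<dots> = (\<Sum>H\<in>Pow E. if H \<in> even_subgraphs E then (t\<^sup>2) ^ card H * 4 ^ N else 0)"
  proof (rule sum.cong[OF refl])
    have four: "((2::real) ^ N)\<^sup>2 = 4 ^ N" by (simp add: power2_eq_square flip: power_mult_distrib)
    fix H assume "H \<in> Pow E"
    then have "H \<subseteq> E" by simp
    then show "(t\<^sup>2) ^ card H * (\<Sum>\<sigma>\<in>?S. \<Prod>e\<in>H. spin_product \<sigma> e)\<^sup>2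
        = (if H \<in> even_subgraphs E then (t\<^sup>2) ^ card H * 4 ^ N else 0)"
      unfolding sum_spin_monomial[OF E \<open>H \<subseteq> E\<close>] by (simp add: four)
  qed
  also have "\<dots> = (\<Sum>H\<in>even_subgraphs E. (t\<^sup>2) ^ card H) * 4 ^ N"
    using fin by (subst sum.inter_filter[symmetric])
      (auto simp: sum_distrib_right even_subgraphs_def intro!: sum.cong)
  finally show ?thesis by simp
qed

section \<open>Even subgraphs and cycles\<close>

definition cycle_edges :: "nat list \<Rightarrow> nat set set" where
  "cycle_edges vs = (\<lambda>i. {vs ! i, vs ! (Suc i mod length vs)}) ` {..<length vs}"

definition cycles :: "nat set set \<Rightarrow> nat set set set" where
  "cycles E = cycle_edges ` {vs. is_cycle E vs}"

text \<open>
  Two edges of a cycle with the same endpoints in opposite order would force length 2.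
\<close>
lemma inj_on_cycle_edges:
  assumes "3 \<le> length vs" "distinct vs"
  shows "inj_on (\<lambda>i. {vs ! i, vs ! (Suc i mod length vs)}) {..<length vs}"
proof (rule inj_onI)
  let ?n = "length vs"
  fix i j
  assume i: "i \<in> {..<?n}" and j: "j \<in> {..<?n}"
    and eq: "{vs ! i, vs ! (Suc i mod ?n)} = {vs ! j, vs ! (Suc j mod ?n)}"
  have lt: "Suc i mod ?n < ?n" "Suc j mod ?n < ?n" using assms(1) by (auto intro: mod_less_divisor)
  from eq consider "vs ! i = vs ! j" | "vs ! i = vs ! (Suc j mod ?n)" "vs ! (Suc i mod ?n) = vs ! j"
    by (auto simp: doubleton_eq_iff)
  then show "i = j"
  proof cases
    case 1
    then show ?thesis using i j assms(2) by (simp add: nth_eq_iff_index_eq)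
  next
    case 2
    have "i = Suc j mod ?n" using 2(1) i lt assms(2) nth_eq_iff_index_eq by blast
    then have "i = Suc j \<or> Suc j = ?n \<and> i = 0" using j by (cases "Suc j = ?n") auto
    moreover have "j = Suc i mod ?n" using 2(2) j lt assms(2) nth_eq_iff_index_eq by blast
    then have "j = Suc i \<or> Suc i = ?n \<and> j = 0" using i by (cases "Suc i = ?n") auto
    ultimately show ?thesis using assms(1) by linarith
  qed
qed

lemma card_cycle_edges: "3 \<le> length vs \<Longrightarrow> distinct vs \<Longrightarrow> card (cycle_edges vs) = length vs"
  unfolding cycle_edges_def by (subst card_image) (auto intro: inj_on_cycle_edges)

text \<open>
  Each edge of the cycle is indexed by its first vertex. Those containing \<open>v\<close> are the ones
  starting and the ones ending at \<open>v\<close>; both kinds are equally many, because the endpoints are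
  listed by the rotated list.
\<close>
lemma even_degree_cycle_edges:
  assumes "3 \<le> length vs" "distinct vs"
  shows "even (degree (cycle_edges vs) v)"
proof -
  let ?n = "length vs" and ?e = "\<lambda>i. {vs ! i, vs ! (Suc i mod length vs)}"
  let ?I = "{i. i < ?n \<and> vs ! i = v}" and ?J = "{i. i < ?n \<and> rotate1 vs ! i = v}"
  have "{e \<in> cycle_edges vs. v \<in> e} = ?e ` {i \<in> {..<?n}. v \<in> ?e i}"
    unfolding cycle_edges_def by (rule Compr_image_eq[where P = "\<lambda>e. v \<in> e"])
  moreover have "card (?e ` {i \<in> {..<?n}. v \<in> ?e i}) = card {i \<in> {..<?n}. v \<in> ?e i}"
    by (rule card_image, rule inj_on_subset[OF inj_on_cycle_edges[OF assms]]) blast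
  ultimately have "degree (cycle_edges vs) v = card {i \<in> {..<?n}. v \<in> ?e i}"
    by (simp only: degree_def)
  also have "{i \<in> {..<?n}. v \<in> ?e i} = ?I \<union> ?J" by (auto simp: nth_rotate1)
  also have "card (?I \<union> ?J) = card ?I + card ?J"
  proof (rule card_Un_disjoint)
    have "Suc i mod ?n \<noteq> i" if "i < ?n" for i using that assms(1) by (auto simp: mod_Suc)
    moreover have "Suc i mod ?n < ?n" for i using assms(1) by (auto intro: mod_less_divisor)
    ultimately show "?I \<inter> ?J = {}" using assms(2)
      by (auto simp: nth_rotate1 nth_eq_iff_index_eq)
  qed auto
  also have "card ?J = card ?I"
  proof -
    have "length (filter (\<lambda>x. x = v) (rotate1 vs)) = length (filter (\<lambda>x. x = v) vs)"
      by (cases vs) auto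
    then show ?thesis by (simp add: length_filter_conv_card)
  qed
  finally show ?thesis by simp
qed

text \<open>
  The first vertex of a longest path has degree at least 2 by parity, and by maximality its
  second neighbour lies on the path, which closes a cycle.
\<close>
lemma exists_cycle:
  assumes E: "simple_graph N E" and H: "H \<in> even_subgraphs E" "H \<noteq> {}"
  shows "\<exists>vs. is_cycle H vs"
proof -
  define P where "P = (\<lambda>vs. distinct vs \<and> 2 \<le> length vs \<and> set vs \<subseteq> {1..N} \<and>
    successively (\<lambda>a b. {a, b} \<in> H) vs)"
  have sub: "H \<subseteq> E" and even: "\<And>v. even (degree H v)" using H by (auto simp: even_subgraphs_def)
  have fin: "finite H" using simple_graph_finite[OF E] sub by (rule rev_finite_subset)
  have edge: "e \<subseteq> {1..N}" "card e = 2" if "e \<in> H" for e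
    using that sub E unfolding simple_graph_def by blast+
  obtain e where e: "e \<in> H" using H by blast
  then obtain a b where ab: "e = {a, b}" "a \<noteq> b" using edge(2)[of e] by (auto simp: card_2_iff)
  then have "P [a, b]" using e edge(1)[OF e] by (auto simp: P_def)
  moreover have "\<forall>vs. P vs \<longrightarrow> length vs < Suc N"
  proof (intro allI impI)
    fix vs assume "P vs"
    then have "distinct vs" "set vs \<subseteq> {1..N}" by (auto simp: P_def)
    moreover from this have "card (set vs) \<le> card {1..N}" by (intro card_mono) auto
    ultimately show "length vs < Suc N" by (simp add: distinct_card)
  qed
  ultimately obtain vs where vs: "P vs" and max: "\<And>ws. P ws \<Longrightarrow> length ws \<le> length vs"
    using ex_has_greatest_nat[of P "[a, b]" length "Suc N"] by blast
  define x where "x = vs ! 0"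
  have len: "2 \<le> length vs" and dist: "distinct vs" and suc: "successively (\<lambda>a b. {a, b} \<in> H) vs"
    and Vs: "set vs \<subseteq> {1..N}"
    using vs by (auto simp: P_def)
  have first: "{x, vs ! 1} \<in> {e \<in> H. x \<in> e}"
    using successively_nth[OF suc, of 0] len by (simp add: x_def)
  have "{e \<in> H. x \<in> e} \<noteq> {{x, vs ! 1}}"
  proof
    assume "{e \<in> H. x \<in> e} = {{x, vs ! 1}}"
    then have "degree H x = 1" by (simp add: degree_def)
    then show False using even[of x] by simp
  qed
  then obtain e' where e': "e' \<in> H" "x \<in> e'" "e' \<noteq> {x, vs ! 1}" using first by blast
  then obtain u where u: "e' = {u, x}" "u \<noteq> x"
    using edge(2)[of e'] by (auto simp: card_2_iff doubleton_eq_iff)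
  have "u \<in> set vs"
  proof (rule ccontr)
    assume "u \<notin> set vs"
    then have "P (u # vs)"
      using len dist suc Vs e' u edge(1)[of e']
      by (cases vs) (auto simp: P_def x_def successively_Cons)
    then show False using max[of "u # vs"] by simp
  qed
  then obtain j where j: "j < length vs" "u = vs ! j" by (auto simp: in_set_conv_nth)
  have "j \<noteq> 0" "j \<noteq> 1" using u e'(3) j by (auto simp: x_def insert_commute)
  then have j2: "2 \<le> j" by simp
  have "is_cycle H (take (Suc j) vs)"
    unfolding is_cycle_def
  proof (intro conjI allI impI)
    show "3 \<le> length (take (Suc j) vs)" using j j2 by simp
    show "distinct (take (Suc j) vs)" using dist by simp
    fix i assume i: "i < length (take (Suc j) vs)"
    have l: "length (take (Suc j) vs) = Suc j" using j by simp
    show "{take (Suc j) vs ! i, take (Suc j) vs ! (Suc i mod length (take (Suc j) vs))} \<in> H"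
    proof (cases "i = j")
      case True
      then show ?thesis using e'(1) u j l by (simp add: x_def)
    next
      case False
      then have "i < j" using i l by simp
      then show ?thesis using successively_nth[OF suc, of i] j l by simp
    qed
  qed
  then show ?thesis by blast
qed

text \<open>
  Removing a cycle keeps all degrees even. The condition on the cardinalities expresses that the
  cycles are pairwise disjoint.
\<close>
lemma cycle_decomposition:
  assumes E: "simple_graph N E" and H: "H \<in> even_subgraphs E"
  shows "\<exists>S\<subseteq>cycles E. finite S \<and> \<Union>S = H \<and> (\<Sum>C\<in>S. card C) = card H"
  using H
proof (induction "card H" arbitrary: H rule: less_induct)
  case less
  have sub: "H \<subseteq> E" and even: "\<And>v. even (degree H v)"
    using less.prems by (auto simp: even_subgraphs_def)
  have fin: "finite H" using simple_graph_finite[OF E] sub by (rule rev_finite_subset)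
  show ?case
  proof (cases "H = {}")
    case True
    then show ?thesis by (intro exI[of _ "{}"]) auto
  next
    case False
    then obtain vs where vs: "is_cycle H vs" using exists_cycle[OF E less.prems] by blast
    define C where "C = cycle_edges vs"
    have len: "3 \<le> length vs" "distinct vs" using vs by (auto simp: is_cycle_def)
    have CH: "C \<subseteq> H" using vs by (auto simp: C_def cycle_edges_def is_cycle_def)
    have C0: "C \<noteq> {}" using len card_cycle_edges[of vs] by (auto simp: C_def)
    have "is_cycle E vs" using vs sub by (auto simp: is_cycle_def)
    then have C_cycle: "C \<in> cycles E" by (auto simp: cycles_def C_def)
    have "even (degree (H - C) v)" for v
    proof -
      have "{e \<in> H. v \<in> e} = {e \<in> H - C. v \<in> e} \<union> {e \<in> C. v \<in> e}" using CH by blast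
      moreover have "card \<dots> = card {e \<in> H - C. v \<in> e} + card {e \<in> C. v \<in> e}"
        using fin finite_subset[OF CH fin] by (intro card_Un_disjoint) auto
      ultimately have "degree H v = degree (H - C) v + degree C v" by (simp add: degree_def)
      then show ?thesis using even[of v] even_degree_cycle_edges[OF len, of v] by (simp add: C_def)
    qed
    then have "H - C \<in> even_subgraphs E" using sub by (auto simp: even_subgraphs_def)
    from less.hyps[OF _ this] obtain S where S: "S \<subseteq> cycles E" "finite S" "\<Union>S = H - C"
        "(\<Sum>C\<in>S. card C) = card (H - C)"
      using psubset_card_mono[OF fin, of "H - C"] CH C0 by blast
    have "C \<notin> S" using S(3) C0 by auto
    then have "(\<Sum>C\<in>insert C S. card C) = card C + card (H - C)" using S by simp
    also have "\<dots> = card H"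
      using fin CH by (metis card_Diff_subset card_mono finite_subset le_add_diff_inverse)
    finally show ?thesis using S C_cycle CH by (intro exI[of _ "insert C S"]) auto
  qed
qed

text \<open>
  A decomposition into cycles determines the subgraph as its union. The left-hand side is
  thus dominated by the sum over all sets of cycles, which factorises.
\<close>
lemma sum_even_subgraphs_le:
  fixes x :: real
  assumes E: "simple_graph N E" and x: "0 \<le> x"
  shows "(\<Sum>H\<in>even_subgraphs E. x ^ card H) \<le> exp (\<Sum>C\<in>cycles E. x ^ card C)"
proof -
  have fin: "finite E" using E by (rule simple_graph_finite)
  have "cycles E \<subseteq> Pow E" by (auto simp: cycles_def cycle_edges_def is_cycle_def)
  then have finC: "finite (cycles E)" using fin by (auto dest: finite_subset)
  obtain S where S: "\<And>H. H \<in> even_subgraphs E \<Longrightarrow>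
      S H \<subseteq> cycles E \<and> finite (S H) \<and> \<Union>(S H) = H \<and> (\<Sum>C\<in>S H. card C) = card H"
    using cycle_decomposition[OF E] by metis
  have inj: "inj_on S (even_subgraphs E)"
    by (rule inj_on_inverseI[where g = Union]) (use S in auto)
  have "(\<Sum>H\<in>even_subgraphs E. x ^ card H) = (\<Sum>H\<in>even_subgraphs E. \<Prod>C\<in>S H. x ^ card C)"
    using S by (intro sum.cong refl) (metis power_sum)
  also have "\<dots> = (\<Sum>T\<in>S ` even_subgraphs E. \<Prod>C\<in>T. x ^ card C)"
    using inj by (simp add: sum.reindex)
  also have "\<dots> \<le> (\<Sum>T\<in>Pow (cycles E). \<Prod>C\<in>T. x ^ card C)"
    using S finC x by (intro sum_mono2) (auto intro!: prod_nonneg)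
  also have "\<dots> = (\<Prod>C\<in>cycles E. x ^ card C + 1)"
    by (simp add: prod_add[OF finC])
  also have "\<dots> \<le> (\<Prod>C\<in>cycles E. exp (x ^ card C))"
    using x by (intro prod_mono) (auto simp: add.commute intro: exp_ge_add_one_self)
  also have "\<dots> = exp (\<Sum>C\<in>cycles E. x ^ card C)" by (simp add: exp_sum[OF finC])
  finally show ?thesis .
qed

text \<open>
  The initial vertex is left out of the lists, so that \<open>n\<close> counts steps.
\<close>
definition walks_from :: "nat set set \<Rightarrow> nat \<Rightarrow> nat \<Rightarrow> nat list set" where
  "walks_from E v n = {vs. length vs = n \<and> successively (\<lambda>a b. {a, b} \<in> E) (v # vs)}"

lemma card_walks_from:
  assumes E: "simple_graph N E" and deg: "\<And>v. degree E v \<le> k"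
  shows "finite (walks_from E v n) \<and> card (walks_from E v n) \<le> k ^ n"
proof (induction n arbitrary: v)
  case 0
  have "walks_from E v 0 = {[]}" by (auto simp: walks_from_def)
  then show ?case by simp
next
  case (Suc n)
  let ?U = "{u. {v, u} \<in> E}"
  have inj: "inj_on (\<lambda>u. {v, u}) ?U" by (rule inj_onI) (auto simp: doubleton_eq_iff)
  have img: "(\<lambda>u. {v, u}) ` ?U \<subseteq> {e \<in> E. v \<in> e}" by auto
  have finE: "finite {e \<in> E. v \<in> e}" using simple_graph_finite[OF E] by simp
  have finU: "finite ?U" using inj img finE by (meson finite_imageD finite_subset)
  have "card ?U \<le> degree E v" unfolding degree_def by (rule card_inj_on_le[OF inj img finE])
  then have cardU: "card ?U \<le> k" using deg[of v] by linarith
  have eq: "walks_from E v (Suc n) = (\<Union>u\<in>?U. (#) u ` walks_from E u n)"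
  proof (intro set_eqI iffI)
    fix vs assume "vs \<in> walks_from E v (Suc n)"
    then show "vs \<in> (\<Union>u\<in>?U. (#) u ` walks_from E u n)"
      by (cases vs) (auto simp: walks_from_def)
  qed (auto simp: walks_from_def)
  have "card (walks_from E v (Suc n)) \<le> (\<Sum>u\<in>?U. card ((#) u ` walks_from E u n))"
    unfolding eq by (rule card_UN_le[OF finU])
  also have "\<dots> \<le> (\<Sum>u\<in>?U. k ^ n)"
    using Suc.IH by (intro sum_mono) (meson card_image_le le_trans)
  also have "\<dots> \<le> k ^ Suc n" using cardU by simp
  finally show ?case unfolding eq using finU Suc.IH by auto
qed

text \<open>
  A cycle is a vertex followed by a walk that starts there, and there are at most \<open>k ^ n\<close>
  walks with \<open>n\<close> steps. A cycle of length \<open>l\<close> uses only \<open>l - 1\<close> steps, whence the exponent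
  \<open>g - 1\<close>.
\<close>
lemma sum_cycles_le:
  fixes x :: real
  assumes E: "simple_graph N E" and deg: "\<And>v. degree E v \<le> k"
    and g: "\<And>vs. is_cycle E vs \<Longrightarrow> g \<le> length vs"
    and x: "0 \<le> x" "x \<le> 1" "x * k < 1"
  shows "(\<Sum>C\<in>cycles E. x ^ card C) \<le> N * (x * k) ^ (g - 1) / (1 - x * k)"
proof -
  let ?Z = "{vs. is_cycle E vs}"
  define q where "q = x * k"
  have q: "0 \<le> q" "q < 1" using x by (auto simp: q_def)
  have Z: "?Z \<subseteq> (\<lambda>(v, n, ws). v # ws) ` (SIGMA v:{1..N}. SIGMA n:{g - 1..<N}. walks_from E v n)"
  proof
    fix vs assume "vs \<in> ?Z"
    then have c: "is_cycle E vs" by simp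
    then have len: "3 \<le> length vs" "distinct vs" "g \<le> length vs" using g by (auto simp: is_cycle_def)
    obtain v ws where vs: "vs = v # ws" using len by (cases vs) auto
    have edge: "{vs ! i, vs ! (Suc i mod length vs)} \<in> E" if "i < length vs" for i
      using c that by (auto simp: is_cycle_def)
    have mem: "vs ! i \<in> {1..N}" if "i < length vs" for i
      using edge[OF that] E by (auto simp: simple_graph_def)
    then have "set vs \<subseteq> {1..N}" by (auto simp: in_set_conv_nth)
    then have "card (set vs) \<le> N" using card_mono[of "{1..N}" "set vs"] by simp
    then have "length vs \<le> N" using len by (simp add: distinct_card)
    moreover have "successively (\<lambda>a b. {a, b} \<in> E) vs"
      unfolding successively_conv_nth using edge by (metis Suc_lessD mod_less)
    ultimately have "(v, length ws, ws) \<in> (SIGMA v:{1..N}. SIGMA n:{g - 1..<N}. walks_from E v n)"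
      using mem[of 0] len vs by (auto simp: walks_from_def)
    then show "vs \<in> (\<lambda>(v, n, ws). v # ws) ` (SIGMA v:{1..N}. SIGMA n:{g - 1..<N}. walks_from E v n)"
      using vs by force
  qed
  have finW: "finite (walks_from E v n)" "card (walks_from E v n) \<le> k ^ n" for v n
    using card_walks_from[OF E deg] by auto
  then have finS: "finite (SIGMA v:{1..N}. SIGMA n:{g - 1..<N}. walks_from E v n)" by auto
  then have finZ: "finite ?Z" using Z by (meson finite_imageI finite_subset)
  have "(\<Sum>C\<in>cycles E. x ^ card C) \<le> (\<Sum>vs\<in>?Z. x ^ card (cycle_edges vs))"
    unfolding cycles_def using sum_image_le[OF finZ, of "\<lambda>C. x ^ card C" cycle_edges] x
    by (simp add: o_def)
  also have "\<dots> = (\<Sum>vs\<in>?Z. x ^ length vs)"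
    by (intro sum.cong refl) (auto simp: is_cycle_def card_cycle_edges)
  also have "\<dots> \<le> (\<Sum>vs\<in>(\<lambda>(v, n, ws). v # ws) `
      (SIGMA v:{1..N}. SIGMA n:{g - 1..<N}. walks_from E v n). x ^ length vs)"
    using Z finS x by (intro sum_mono2) auto
  also have "\<dots> \<le> (\<Sum>(v, n, ws)\<in>(SIGMA v:{1..N}. SIGMA n:{g - 1..<N}. walks_from E v n). x ^ Suc (length ws))"
    using sum_image_le[OF finS, of "\<lambda>vs. x ^ length vs" "\<lambda>(v, n, ws). v # ws"] x
    by (simp add: o_def case_prod_beta)
  also have "\<dots> = (\<Sum>v\<in>{1..N}. \<Sum>n\<in>{g - 1..<N}. \<Sum>ws\<in>walks_from E v n. x ^ Suc (length ws))"
    using finW by (simp add: sum.Sigma)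
  also have "\<dots> = (\<Sum>v\<in>{1..N}. \<Sum>n\<in>{g - 1..<N}. card (walks_from E v n) * x ^ Suc n)"
    by (intro sum.cong refl) (simp add: walks_from_def)
  also have "\<dots> \<le> (\<Sum>v\<in>{1..N}. \<Sum>n\<in>{g - 1..<N}. q ^ n)"
  proof (intro sum_mono)
    fix v n
    have "card (walks_from E v n) * x ^ Suc n \<le> real k ^ n * x ^ n"
      using finW(2)[of v n] x
      by (intro mult_mono) (auto simp: mult_left_le_one_le simp flip: of_nat_power)
    then show "card (walks_from E v n) * x ^ Suc n \<le> q ^ n"
      by (simp add: q_def power_mult_distrib mult.commute)
  qed
  also have "\<dots> = N * (\<Sum>n\<in>{g - 1..<N}. q ^ n)" by simp
  also have "\<dots> \<le> N * (q ^ (g - 1) / (1 - q))"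
  proof (rule mult_left_mono)
    have "(\<lambda>i. q ^ (i + (g - 1))) sums (q ^ (g - 1) * (1 / (1 - q)))"
      using geometric_sums[of q, THEN sums_mult, of "q ^ (g - 1)"] q by (simp add: power_add mult.commute)
    then have tail: "(\<Sum>i<N - (g - 1). q ^ (i + (g - 1))) \<le> q ^ (g - 1) * (1 / (1 - q))"
      using q by (metis sum_le_suminf sums_iff finite_lessThan zero_le_power)
    have "(\<Sum>n\<in>{g - 1..<N}. q ^ n) = (\<Sum>i<N - (g - 1). q ^ (i + (g - 1)))"
      by (rule sum.reindex_bij_witness[of _ "\<lambda>i. i + (g - 1)" "\<lambda>n. n - (g - 1)"]) auto
    then show "(\<Sum>n\<in>{g - 1..<N}. q ^ n) \<le> q ^ (g - 1) / (1 - q)" using tail by simp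
  qed simp
  finally show ?thesis by (simp add: q_def)
qed

section \<open>The free energy as a function of the edge signs\<close>

text \<open>
  Every edge is counted by its two orientations.
\<close>
lemma sum_over_edges:
  fixes f :: "nat set \<Rightarrow> real"
  assumes E: "simple_graph N E"
  shows "(\<Sum>i\<in>{1..N}. \<Sum>j\<in>{1..N}. if {i, j} \<in> E then f {i, j} else 0) = 2 * (\<Sum>e\<in>E. f e)"
proof -
  let ?P = "{p \<in> {1..N} \<times> {1..N}. {fst p, snd p} \<in> E}"
  have "(\<Sum>i\<in>{1..N}. \<Sum>j\<in>{1..N}. if {i, j} \<in> E then f {i, j} else 0)
      = (\<Sum>p\<in>{1..N} \<times> {1..N}. if {fst p, snd p} \<in> E then f {fst p, snd p} else 0)"
    by (simp add: sum.cartesian_product case_prod_beta)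
  also have "\<dots> = (\<Sum>p\<in>?P. f {fst p, snd p})" by (rule sum.inter_filter[symmetric]) simp
  also have "\<dots> = (\<Sum>e\<in>E. \<Sum>p\<in>{p \<in> ?P. {fst p, snd p} = e}. f {fst p, snd p})"
    by (rule sum.group[symmetric]) (use simple_graph_finite[OF E] in auto)
  also have "\<dots> = (\<Sum>e\<in>E. 2 * f e)"
  proof (rule sum.cong[OF refl])
    fix e assume e: "e \<in> E"
    then obtain a b where ab: "e = {a, b}" "a \<noteq> b" "a \<in> {1..N}" "b \<in> {1..N}"
      using E by (fastforce simp: simple_graph_def card_2_iff)
    have "{p \<in> ?P. {fst p, snd p} = e} = {(a, b), (b, a)}"
      using e ab by (auto simp: doubleton_eq_iff insert_commute)
    then show "(\<Sum>p\<in>{p \<in> ?P. {fst p, snd p} = e}. f {fst p, snd p}) = 2 * f e"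
      using ab by (simp add: insert_commute)
  qed
  finally show ?thesis by (simp add: sum_distrib_left)
qed

lemma handshake:
  assumes "regular_graph k N E"
  shows "2 * card E = k * N"
proof -
  have E: "simple_graph N E" and deg: "\<And>v. v \<in> {1..N} \<Longrightarrow> degree E v = k"
    using assms by (auto simp: regular_graph_def)
  have fin: "finite E" using E by (rule simple_graph_finite)
  have "k * N = (\<Sum>v\<in>{1..N}. degree E v)" using deg by simp
  also have "\<dots> = (\<Sum>v\<in>{1..N}. \<Sum>e\<in>E. if v \<in> e then 1 else 0)"
    using fin by (simp add: degree_def sum.If_cases Int_def)
  also have "\<dots> = (\<Sum>e\<in>E. \<Sum>v\<in>{1..N}. if v \<in> e then 1 else 0)" by (rule sum.swap)
  also have "\<dots> = (\<Sum>e\<in>E. 2)"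
  proof (rule sum.cong[OF refl])
    fix e assume "e \<in> E"
    then have "{1..N} \<inter> {v. v \<in> e} = e" "card e = 2" using E by (auto simp: simple_graph_def)
    then show "(\<Sum>v\<in>{1..N}. if v \<in> e then 1 else 0) = (2::nat)" by (simp add: sum.If_cases)
  qed
  finally show ?thesis by simp
qed

definition sign_partition :: "nat \<Rightarrow> nat set set \<Rightarrow> real \<Rightarrow> (nat set \<Rightarrow> real) \<Rightarrow> real" where
  "sign_partition N E \<beta> s = (\<Sum>\<sigma>\<in>signs {1..N}. exp (\<Sum>e\<in>E. \<beta> * s e * spin_product \<sigma> e))"

lemma sign_partition_pos: "0 < sign_partition N E \<beta> s"
  unfolding sign_partition_def
  by (intro sum_pos) (auto simp: PiE_eq_empty_iff)

text \<open>
  The identity \<open>exp (\<beta> b) = cosh \<beta> (1 + tanh \<beta> b)\<close> for a sign \<open>b\<close>, applied to every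
  edge.
\<close>
lemma sign_partition_reduced:
  assumes E: "simple_graph N E" and s: "s \<in> signs E"
  shows "sign_partition N E \<beta> s = 2 ^ N * cosh \<beta> ^ card E * reduced_partition N E (tanh \<beta>) s"
proof -
  have "exp (\<Sum>e\<in>E. \<beta> * s e * spin_product \<sigma> e)
      = cosh \<beta> ^ card E * (\<Prod>e\<in>E. 1 + tanh \<beta> * s e * spin_product \<sigma> e)"
    if \<sigma>: "\<sigma> \<in> signs {1..N}" for \<sigma>
  proof -
    have "exp (\<beta> * s e * spin_product \<sigma> e) = cosh \<beta> * (1 + tanh \<beta> * s e * spin_product \<sigma> e)"
      if e: "e \<in> E" for e
    proof -
      have "s e \<in> {-1, 1}" using s e by auto
      then have "s e * spin_product \<sigma> e \<in> {-1, 1}" using spin_product_sign[OF E \<sigma> e] by auto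
      moreover have "exp (\<beta> * b) = cosh \<beta> * (1 + tanh \<beta> * b)" if "b \<in> {-1, 1}" for b
      proof -
        have "cosh \<beta> * (1 + tanh \<beta> * b) = cosh \<beta> + sinh \<beta> * b"
          by (simp add: tanh_def distrib_left)
        then show ?thesis using that cosh_plus_sinh[of \<beta>] cosh_minus_sinh[of \<beta>] by auto
      qed
      ultimately show ?thesis by (metis mult.assoc)
    qed
    then show ?thesis
      by (simp add: exp_sum[OF simple_graph_finite[OF E]] prod.distrib)
  qed
  then have "sign_partition N E \<beta> s = (\<Sum>\<sigma>\<in>signs {1..N}.
      cosh \<beta> ^ card E * (\<Prod>e\<in>E. 1 + tanh \<beta> * s e * spin_product \<sigma> e))"
    unfolding sign_partition_def by (intro sum.cong refl)
  then show ?thesis by (simp add: reduced_partition_def flip: sum_distrib_left)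
qed

lemma reduced_partition_pos:
  assumes "simple_graph N E" "s \<in> signs E"
  shows "0 < reduced_partition N E (tanh \<beta>) s"
proof (rule zero_less_mult_pos)
  show "0 < (2 ^ N * cosh \<beta> ^ card E) * reduced_partition N E (tanh \<beta>) s"
    using sign_partition_pos[of N E \<beta> s] unfolding sign_partition_reduced[OF assms] .
qed simp

lemma ising_free_energy_signs:
  assumes E: "simple_graph N E" and s: "s \<in> signs E" and N: "0 < N"
    and A: "\<And>i j. i \<in> {1..N} \<Longrightarrow> j \<in> {1..N} \<Longrightarrow> A i j = (if {i, j} \<in> E then \<beta> * s {i, j} else 0)"
  shows "ising_free_energy N A (\<lambda>_. 0)
    = ln 2 + card E / N * ln (cosh \<beta>) + ln (reduced_partition N E (tanh \<beta>) s) / N"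
proof -
  have energy: "1 / 2 * (\<Sum>i\<in>{1..N}. \<sigma> i * (\<Sum>j\<in>{1..N}. A i j * \<sigma> j)) + (\<Sum>i\<in>{1..N}. 0 * \<sigma> i)
      = (\<Sum>e\<in>E. \<beta> * s e * spin_product \<sigma> e)" for \<sigma>
  proof -
    have "(\<Sum>i\<in>{1..N}. \<sigma> i * (\<Sum>j\<in>{1..N}. A i j * \<sigma> j))
        = (\<Sum>i\<in>{1..N}. \<Sum>j\<in>{1..N}. if {i, j} \<in> E then \<beta> * s {i, j} * spin_product \<sigma> {i, j} else 0)"
      unfolding sum_distrib_left
    proof (intro sum.cong refl)
      fix i j assume ij: "i \<in> {1..N}" "j \<in> {1..N}"
      have "i \<noteq> j" if "{i, j} \<in> E" using that E by (auto simp: simple_graph_def)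
      then show "\<sigma> i * (A i j * \<sigma> j)
          = (if {i, j} \<in> E then \<beta> * s {i, j} * spin_product \<sigma> {i, j} else 0)"
        using A[OF ij] by simp
    qed
    also have "\<dots> = 2 * (\<Sum>e\<in>E. \<beta> * s e * spin_product \<sigma> e)"
      by (rule sum_over_edges[OF E])
    finally show ?thesis by simp
  qed
  have W: "0 < reduced_partition N E (tanh \<beta>) s"
    by (rule reduced_partition_pos[OF E s])
  have "ising_free_energy N A (\<lambda>_. 0) = 1 / N * ln (sign_partition N E \<beta> s)"
    unfolding ising_free_energy_def energy sign_partition_def ..
  also have "ln (sign_partition N E \<beta> s)
      = N * ln 2 + card E * ln (cosh \<beta>) + ln (reduced_partition N E (tanh \<beta>) s)"
    unfolding sign_partition_reduced[OF E s] using W by (simp add: ln_mult ln_realpow)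
  finally show ?thesis using N by (simp add: field_simps)
qed

text \<open>
  Flipping one sign changes the energy of each configuration by at most \<open>2 |\<beta>|\<close>, so it
  changes the partition function by a factor of at most \<open>exp 2\<close>.
\<close>
lemma ln_reduced_partition_flip:
  assumes E: "simple_graph N E" and \<beta>: "\<bar>\<beta>\<bar> \<le> 1" and s: "s \<in> signs E" and e: "e \<in> E"
  shows "\<bar>ln (reduced_partition N E (tanh \<beta>) (s(e := 1)))
    - ln (reduced_partition N E (tanh \<beta>) (s(e := -1)))\<bar> \<le> 2"
proof -
  have ins: "insert e E = E" using e by auto
  have mem: "s(e := b) \<in> signs E" if "b \<in> {-1, 1}" for b
    using fun_upd_signs[OF s that, of e] unfolding ins .
  have le: "sign_partition N E \<beta> (s(e := b)) \<le> exp 2 * sign_partition N E \<beta> (s(e := c))"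
    if b: "b \<in> {-1, 1}" and c: "c \<in> {-1, 1}" for b c
    unfolding sign_partition_def sum_distrib_left
  proof (rule sum_mono)
    fix \<sigma> assume \<sigma>: "\<sigma> \<in> signs {1..N}"
    have "(\<Sum>f\<in>E. \<beta> * (s(e := b)) f * spin_product \<sigma> f) - (\<Sum>f\<in>E. \<beta> * (s(e := c)) f * spin_product \<sigma> f)
        = (\<Sum>f\<in>E. if f = e then \<beta> * (b - c) * spin_product \<sigma> e else 0)"
      unfolding sum_subtractf[symmetric] by (rule sum.cong) (auto simp: algebra_simps)
    also have "\<dots> = \<beta> * (b - c) * spin_product \<sigma> e"
      using e simple_graph_finite[OF E] by simp
    also have "\<dots> \<le> 2" using b c spin_product_sign[OF E \<sigma> e] \<beta> by auto
    finally show "exp (\<Sum>f\<in>E. \<beta> * (s(e := b)) f * spin_product \<sigma> f)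
        \<le> exp 2 * exp (\<Sum>f\<in>E. \<beta> * (s(e := c)) f * spin_product \<sigma> f)"
      by (simp flip: exp_add)
  qed
  have "ln (reduced_partition N E (tanh \<beta>) (s(e := b)))
      \<le> 2 + ln (reduced_partition N E (tanh \<beta>) (s(e := c)))"
    if b: "b \<in> {-1, 1}" and c: "c \<in> {-1, 1}" for b c
  proof -
    note pos = reduced_partition_pos[OF E mem[OF b], of \<beta>] reduced_partition_pos[OF E mem[OF c], of \<beta>]
    have "2 ^ N * cosh \<beta> ^ card E * reduced_partition N E (tanh \<beta>) (s(e := b))
        \<le> 2 ^ N * cosh \<beta> ^ card E * (exp 2 * reduced_partition N E (tanh \<beta>) (s(e := c)))"
      using le[OF b c] unfolding sign_partition_reduced[OF E mem[OF b]]
        sign_partition_reduced[OF E mem[OF c]] by (simp only: mult.left_commute mult.assoc)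
    then have "reduced_partition N E (tanh \<beta>) (s(e := b))
        \<le> exp 2 * reduced_partition N E (tanh \<beta>) (s(e := c))"
      by (subst (asm) mult_le_cancel_left_pos) (auto intro!: mult_pos_pos)
    then have "ln (reduced_partition N E (tanh \<beta>) (s(e := b)))
        \<le> ln (exp 2 * reduced_partition N E (tanh \<beta>) (s(e := c)))"
      using pos by (subst ln_le_cancel_iff) auto
    then show ?thesis using pos by (simp add: ln_mult)
  qed
  from this[of 1 "-1"] this[of "-1" 1] show ?thesis by simp
qed

section \<open>From the cube of signs to the random weights\<close>

lemma tanh_square_le: "(tanh x)\<^sup>2 \<le> x\<^sup>2" for x :: real
proof -
  have "0 - tanh 0 \<le> \<bar>x\<bar> - tanh \<bar>x\<bar>"
  proof (rule DERIV_nonneg_imp_nondecreasing[of 0 "\<bar>x\<bar>" "\<lambda>y. y - tanh y"])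
    fix y :: real
    have "((\<lambda>y. y - tanh y) has_real_derivative (tanh y)\<^sup>2) (at y)"
      by (auto intro!: derivative_eq_intros)
    then show "\<exists>d. ((\<lambda>y. y - tanh y) has_real_derivative d) (at y) \<and> 0 \<le> d"
      by (intro exI[of _ "(tanh y)\<^sup>2"]) simp
  qed simp
  then have "\<bar>tanh x\<bar> \<le> \<bar>x\<bar>" by simp
  then show ?thesis by (simp add: abs_le_square_iff)
qed

lemma uniform_signs_prob:
  assumes X: "uniform_signs M \<beta> X" and "\<beta> \<noteq> 0" "c \<in> {-\<beta>, \<beta>}"
  shows "measure M (X -` {c} \<inter> space M) = 1 / 2"
proof -
  have [measurable]: "X \<in> borel_measurable M" using X by (simp add: uniform_signs_def)
  have "measure M (X -` {c} \<inter> space M) = measure (distr M borel X) {c}"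
    by (subst measure_distr) auto
  also have "\<dots> = measure (distr (measure_pmf (pmf_of_set {-\<beta>, \<beta>})) borel (\<lambda>x. x)) {c}"
    using X by (simp add: uniform_signs_def)
  also have "\<dots> = pmf (pmf_of_set {-\<beta>, \<beta>}) c"
    by (subst measure_distr) (auto simp: measure_pmf_single)
  also have "\<dots> = 1 / 2" using assms by (auto simp: card_insert_if)
  finally show ?thesis .
qed

lemma uniform_signs_AE:
  assumes X: "uniform_signs M \<beta> X"
  shows "AE \<omega> in M. X \<omega> \<in> {-\<beta>, \<beta>}"
proof -
  have [measurable]: "X \<in> borel_measurable M" using X by (simp add: uniform_signs_def)
  have "AE x in distr (measure_pmf (pmf_of_set {-\<beta>, \<beta>})) borel (\<lambda>x. x). x \<in> {-\<beta>, \<beta>}"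
    by (subst AE_distr_iff) (auto simp: AE_measure_pmf_iff)
  moreover have "distr M borel X = distr (measure_pmf (pmf_of_set {-\<beta>, \<beta>})) borel (\<lambda>x. x)"
    using X by (simp add: uniform_signs_def)
  ultimately have "AE x in distr M borel X. x \<in> {-\<beta>, \<beta>}" by (simp only:)
  then show ?thesis by (subst (asm) AE_distr_iff) auto
qed

lemma sign_pattern_prob:
  assumes M: "prob_space M" and E: "simple_graph N E" "E \<noteq> {}" and A: "random_sign_weights M \<beta> N E A"
    and \<beta>: "\<beta> \<noteq> 0" and s: "s \<in> signs E"
  defines "P \<equiv> {\<omega> \<in> space M. \<forall>i j. i < j \<and> {i, j} \<in> E \<longrightarrow> A i j \<omega> = \<beta> * s {i, j}}"
  shows "P \<in> sets M" "measure M P = 1 / 2 ^ card E"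
proof -
  interpret prob_space M by fact
  let ?I = "{(i, j). i < j \<and> {i, j} \<in> E}"
  let ?X = "\<lambda>(i, j). A i j" and ?c = "\<lambda>(i, j). \<beta> * s {i, j}"
  have mem: "i \<in> {1..N}" "j \<in> {1..N}" if "{i, j} \<in> E" for i j
    using bspec[OF E(1)[unfolded simple_graph_def] that] by simp_all
  have unif: "uniform_signs M \<beta> (?X p)" if "p \<in> ?I" for p
  proof -
    obtain i j where p: "p = (i, j)" by (cases p)
    then have "{i, j} \<in> E" using that by simp
    then show ?thesis using A mem[of i j] by (simp add: p random_sign_weights_def)
  qed
  have bij: "bij_betw (\<lambda>(i, j). {i, j}) ?I E"
  proof (rule bij_betwI')
    fix e assume e: "e \<in> E"
    then have "card e = 2" using E(1) unfolding simple_graph_def by blast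
    then obtain a b where ab: "e = {a, b}" "a \<noteq> b" unfolding card_2_iff by blast
    show "\<exists>p\<in>?I. e = (case p of (i, j) \<Rightarrow> {i, j})"
    proof (cases "a < b")
      case True
      then show ?thesis using e ab by (intro bexI[of _ "(a, b)"]) auto
    next
      case False
      then have "b < a" using ab(2) by simp
      then show ?thesis using e ab(1) by (intro bexI[of _ "(b, a)"]) (simp_all add: insert_commute)
    qed
  next
    fix p q assume "p \<in> ?I" "q \<in> ?I"
    then show "((case p of (i, j) \<Rightarrow> {i, j}) = (case q of (i, j) \<Rightarrow> {i, j})) = (p = q)"
      by (cases p; cases q) (auto simp: doubleton_eq_iff)
  next
    fix p assume "p \<in> ?I"
    then show "(case p of (i, j) \<Rightarrow> {i, j}) \<in> E" by (cases p) simp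
  qed
  have fin: "finite ?I" using bij_betw_finite[OF bij] simple_graph_finite[OF E(1)] by simp
  have ne: "?I \<noteq> {}" using bij_betw_imp_surj_on[OF bij] E(2) by (metis image_empty)
  have P: "P = (\<Inter>p\<in>?I. ?X p -` {?c p} \<inter> space M)" using ne by (auto simp: P_def)
  have "?X p -` {?c p} \<inter> space M \<in> sets M" if "p \<in> ?I" for p
  proof (rule measurable_sets)
    show "?X p \<in> borel_measurable M" using unif[OF that] by (simp add: uniform_signs_def)
  qed simp
  then show "P \<in> sets M" unfolding P using fin ne by (intro sets.finite_INT) auto
  have "measure M P = (\<Prod>p\<in>?I. measure M (?X p -` {?c p} \<inter> space M))"
    unfolding P using A fin ne by (intro indep_varsD_finite) (auto simp: random_sign_weights_def)
  also have "\<dots> = (\<Prod>p\<in>?I. 1 / 2)"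
  proof (rule prod.cong[OF refl], rule uniform_signs_prob[OF unif \<beta>])
    fix p assume p: "p \<in> ?I"
    then have "s (case p of (i, j) \<Rightarrow> {i, j}) \<in> {-1, 1}" using s by auto
    then show "?c p \<in> {-\<beta>, \<beta>}" by (cases p) auto
  qed
  also have "\<dots> = 1 / 2 ^ card E"
    using bij_betw_same_card[OF bij] by (simp add: power_one_over)
  finally show "measure M P = 1 / 2 ^ card E" .
qed

text \<open>
  Transfers counting on the cube to the probability space. The event is a finite union of cylinders,
  so that it is measurable without any property of the functions evaluated on the weights.
\<close>
lemma sign_patterns_prob_le:
  assumes M: "prob_space M" and E: "simple_graph N E" "E \<noteq> {}" and A: "random_sign_weights M \<beta> N E A"
    and \<beta>: "\<beta> \<noteq> 0" and S: "S \<subseteq> signs E"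
  defines "P \<equiv> {\<omega> \<in> space M. \<exists>s\<in>S. \<forall>i j. i < j \<and> {i, j} \<in> E \<longrightarrow> A i j \<omega> = \<beta> * s {i, j}}"
  shows "P \<in> sets M" "measure M P \<le> card S / 2 ^ card E"
proof -
  interpret prob_space M by fact
  let ?Q = "\<lambda>s. {\<omega> \<in> space M. \<forall>i j. i < j \<and> {i, j} \<in> E \<longrightarrow> A i j \<omega> = \<beta> * s {i, j}}"
  have fin: "finite S" using S simple_graph_finite[OF E(1)] by (auto intro: finite_subset)
  have Q: "?Q s \<in> sets M" "measure M (?Q s) = 1 / 2 ^ card E" if "s \<in> S" for s
  proof -
    have "s \<in> signs E" using S that by blast
    from sign_pattern_prob[OF M E A \<beta> this]
    show "?Q s \<in> sets M" "measure M (?Q s) = 1 / 2 ^ card E" by this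
  qed
  have P: "P = (\<Union>s\<in>S. ?Q s)" by (auto simp: P_def)
  show "P \<in> sets M" unfolding P by (rule sets.finite_UN[OF fin Q(1)])
  have "measure M P \<le> (\<Sum>s\<in>S. measure M (?Q s))"
    unfolding P by (rule measure_UNION_le[OF fin Q(1)])
  also have "\<dots> = (\<Sum>s\<in>S. 1 / 2 ^ card E)" by (rule sum.cong[OF refl Q(2)])
  also have "\<dots> = card S / 2 ^ card E" by simp
  finally show "measure M P \<le> card S / 2 ^ card E" .
qed

text \<open>
  Outside a null set the weights are \<open>\<beta>\<close> times a point of the cube of signs. This also
  covers \<open>\<beta> = 0\<close>, where that point is not unique.
\<close>
lemma random_sign_weights_AE:
  assumes M: "prob_space M" and E: "simple_graph N E" and A: "random_sign_weights M \<beta> N E A"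
  shows "AE \<omega> in M. \<exists>s\<in>signs E. \<forall>i\<in>{1..N}. \<forall>j\<in>{1..N}.
    A i j \<omega> = (if {i, j} \<in> E then \<beta> * s {i, j} else 0)"
proof -
  have "AE \<omega> in M. \<forall>i\<in>{1..N}. \<forall>j\<in>{1..N}. {i, j} \<in> E \<longrightarrow> A i j \<omega> \<in> {-\<beta>, \<beta>}"
  proof (intro AE_finite_allI finite_atLeastAtMost)
    fix i j assume ij: "i \<in> {1..N}" "j \<in> {1..N}"
    show "AE \<omega> in M. {i, j} \<in> E \<longrightarrow> A i j \<omega> \<in> {-\<beta>, \<beta>}"
    proof (cases "{i, j} \<in> E")
      case True
      then have "uniform_signs M \<beta> (A i j)" using A ij by (simp add: random_sign_weights_def)
      from uniform_signs_AE[OF this] show ?thesis by eventually_elim simp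
    qed simp
  qed
  then show ?thesis
  proof (rule AE_mp, intro AE_I2 impI)
    fix \<omega> assume \<omega>: "\<omega> \<in> space M"
      and val: "\<forall>i\<in>{1..N}. \<forall>j\<in>{1..N}. {i, j} \<in> E \<longrightarrow> A i j \<omega> \<in> {-\<beta>, \<beta>}"
    \<comment> \<open>\<open>Min\<close> and \<open>Max\<close> choose one of the two orientations of an edge; \<open>A\<close> is symmetric.\<close>
    define s where "s = (\<lambda>e\<in>E. if A (Min e) (Max e) \<omega> = \<beta> then 1 else - 1 :: real)"
    have "A i j \<omega> = (if {i, j} \<in> E then \<beta> * s {i, j} else 0)" if ij: "i \<in> {1..N}" "j \<in> {1..N}" for i j
    proof (cases "{i, j} \<in> E")
      case True
      have "A (Min {i, j}) (Max {i, j}) \<omega> = A i j \<omega>"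
        using A ij \<omega> by (auto simp: random_sign_weights_def min_def max_def)
      moreover have "A i j \<omega> \<in> {-\<beta>, \<beta>}" using val ij True by blast
      ultimately show ?thesis using True by (auto simp: s_def)
    next
      case False
      then show ?thesis using A ij \<omega> by (auto simp: random_sign_weights_def)
    qed
    moreover have "s \<in> signs E" by (auto simp: s_def)
    ultimately show "\<exists>s\<in>signs E. \<forall>i\<in>{1..N}. \<forall>j\<in>{1..N}.
        A i j \<omega> = (if {i, j} \<in> E then \<beta> * s {i, j} else 0)" by blast
  qed
qed

text \<open>
  The estimate for a single \<open>N\<close>. The assumption \<open>small\<close> compares the bound
  \<open>exp (2 N 2\<^sup>1\<^sup>-\<^sup>g)\<close> for the second moment with the concentration at distance \<open>r\<close>; the
  graph has \<open>k N / 2\<close> edges.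
\<close>
lemma free_energy_deviation_set:
  assumes M: "prob_space M" and E: "regular_graph k N E" and kN: "0 < k" "0 < N"
    and A: "random_sign_weights M \<beta> N E A" and \<beta>: "\<bar>\<beta>\<bar> \<le> 1" "\<beta>\<^sup>2 * k \<le> 1 / 2" and r: "0 < r"
    and g: "\<And>vs. is_cycle E vs \<Longrightarrow> g \<le> length vs"
    and small: "exp (2 * real N * (1 / 2) ^ (g - 1) - r\<^sup>2 / (real k * real N)) < 1 / 4"
  shows "\<exists>B\<in>sets M. measure M B \<le> exp (- r) + exp (- r\<^sup>2 / (real k * real N)) \<and>
    (AE \<omega> in M. \<omega> \<notin> B \<longrightarrow>
      \<bar>ising_free_energy N (\<lambda>i j. A i j \<omega>) (\<lambda>_. 0) - (ln 2 + k / 2 * ln (cosh \<beta>))\<bar> \<le> (ln 2 + 2 * r) / N)"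
proof -
  interpret prob_space M by fact
  have sg: "simple_graph N E" using E by (simp add: regular_graph_def)
  have fin: "finite E" using sg by (rule simple_graph_finite)
  have m: "2 * real (card E) = real k * real N"
    using handshake[OF E] by (metis of_nat_mult of_nat_numeral)
  then have ne: "E \<noteq> {}" using kN by auto
  define W where "W = reduced_partition N E (tanh \<beta>)"
  define S where "S = {s \<in> signs E. r \<le> ln (W s) \<or> ln (W s) \<le> - ln 2 - 2 * r}"
  define x where "x = (tanh \<beta>)\<^sup>2"
  have xk: "x * k \<le> 1 / 2" using \<beta>(2) tanh_square_le[of \<beta>] mult_right_mono[of x "\<beta>\<^sup>2" "real k"]
    by (simp add: x_def)
  have "\<beta>\<^sup>2 \<le> 1" using \<beta>(1) by (simp only: abs_square_le_1)
  then have x1: "0 \<le> x" "x \<le> 1" using tanh_square_le[of \<beta>] by (auto simp: x_def)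
  have deg: "degree E v \<le> k" for v
  proof (cases "v \<in> {1..N}")
    case False
    then have "{e \<in> E. v \<in> e} = {}" using sg unfolding simple_graph_def by blast
    then show ?thesis by (simp only: degree_def card.empty le0)
  qed (use E in \<open>simp add: regular_graph_def\<close>)
  have "(\<Sum>H\<in>even_subgraphs E. x ^ card H) \<le> exp (\<Sum>C\<in>cycles E. x ^ card C)"
    by (rule sum_even_subgraphs_le[OF sg x1(1)])
  also have "(\<Sum>C\<in>cycles E. x ^ card C) \<le> N * (x * k) ^ (g - 1) / (1 - x * k)"
    using sum_cycles_le[OF sg deg g, where x = x] x1 xk by simp
  also have "\<dots> \<le> N * (1 / 2) ^ (g - 1) / (1 / 2)"
    using xk x1 by (intro frac_le mult_left_mono power_mono) auto
  finally have even_sum: "(\<Sum>H\<in>even_subgraphs E. x ^ card H) \<le> exp (2 * real N * (1 / 2) ^ (g - 1))"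
    by (simp add: mult_ac)
  have S: "card S \<le> 2 ^ card E * (exp (- r) + exp (- r\<^sup>2 / (2 * card E)))"
    unfolding S_def
  proof (rule log_deviation_signs[OF fin ne, where B = "exp (2 * real N * (1 / 2) ^ (g - 1))"])
    show "0 < W s" if "s \<in> signs E" for s using reduced_partition_pos[OF sg that] by (simp add: W_def)
    show "(\<Sum>s\<in>signs E. W s) = 2 ^ card E" unfolding W_def by (rule first_moment[OF sg])
    show "(\<Sum>s\<in>signs E. (W s)\<^sup>2) \<le> 2 ^ card E * exp (2 * real N * (1 / 2) ^ (g - 1))"
      unfolding W_def second_moment[OF sg] using even_sum by (simp add: x_def)
    show "\<bar>ln (W (s(e := 1))) - ln (W (s(e := -1)))\<bar> \<le> 2" if "s \<in> signs E" "e \<in> E" for s e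
      unfolding W_def by (rule ln_reduced_partition_flip[OF sg \<beta>(1) that])
    have "real (2 * card E) = real k * real N" using m by simp
    moreover have "exp (- x / y) * (4 * exp z) = 4 * exp (z - x / y)" for x y z :: real
      by (simp add: exp_diff exp_minus field_simps)
    ultimately show "exp (- r\<^sup>2 / real (2 * card E)) * (4 * exp (2 * real N * (1 / 2) ^ (g - 1))) < 1"
      using small by (simp only:)
  qed (use r in simp)
  \<comment> \<open>For \<open>\<beta> = 0\<close> all sign patterns give the same weights, so the set of patterns says nothing
    about probabilities; but then \<open>W = 1\<close> and the exceptional set is empty.\<close>
  define B where "B = (if \<beta> = 0 then {} else
    {\<omega> \<in> space M. \<exists>s\<in>S. \<forall>i j. i < j \<and> {i, j} \<in> E \<longrightarrow> A i j \<omega> = \<beta> * s {i, j}})"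
  have "B \<in> sets M" "measure M B \<le> exp (- r) + exp (- r\<^sup>2 / (real k * real N))"
  proof -
    have "S \<subseteq> signs E" by (auto simp: S_def)
    note P = sign_patterns_prob_le[OF M sg ne A _ this]
    show "B \<in> sets M" using P(1) by (simp add: B_def)
    have "card S / 2 ^ card E \<le> exp (- r) + exp (- r\<^sup>2 / (real k * real N))"
      using S m by (simp add: divide_le_eq mult.commute)
    then show "measure M B \<le> exp (- r) + exp (- r\<^sup>2 / (real k * real N))"
      using P(2) by (auto simp: B_def intro: order_trans)
  qed
  moreover have "AE \<omega> in M. \<omega> \<notin> B \<longrightarrow>
      \<bar>ising_free_energy N (\<lambda>i j. A i j \<omega>) (\<lambda>_. 0) - (ln 2 + k / 2 * ln (cosh \<beta>))\<bar> \<le> (ln 2 + 2 * r) / N"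
    using random_sign_weights_AE[OF M sg A]
  proof (rule AE_mp, intro AE_I2 impI)
    fix \<omega> assume \<omega>: "\<omega> \<in> space M" "\<omega> \<notin> B" and "\<exists>s\<in>signs E. \<forall>i\<in>{1..N}. \<forall>j\<in>{1..N}.
        A i j \<omega> = (if {i, j} \<in> E then \<beta> * s {i, j} else 0)"
    then obtain s where s: "s \<in> signs E"
      and eq: "\<And>i j. i \<in> {1..N} \<Longrightarrow> j \<in> {1..N} \<Longrightarrow> A i j \<omega> = (if {i, j} \<in> E then \<beta> * s {i, j} else 0)"
      by blast
    have "s \<notin> S"
    proof (cases "\<beta> = 0")
      case True
      then have "W s = 1" by (simp add: W_def reduced_partition_def card_signs)
      moreover have "- ln 2 - 2 * r < 0" using r ln_gt_zero[of "2 :: real"] by linarith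
      ultimately show ?thesis using r by (simp add: S_def)
    next
      case False
      have "A i j \<omega> = \<beta> * s {i, j}" if "{i, j} \<in> E" for i j
        using that eq[of i j] bspec[OF sg[unfolded simple_graph_def] that] by simp
      then show ?thesis using \<omega> False by (auto simp: B_def)
    qed
    then have "ln (W s) < r" "- ln 2 - 2 * r < ln (W s)" using s by (auto simp: S_def)
    then have "\<bar>ln (W s)\<bar> \<le> ln 2 + 2 * r" using r ln_gt_zero[of "2 :: real"] by linarith
    moreover have "ising_free_energy N (\<lambda>i j. A i j \<omega>) (\<lambda>_. 0) - (ln 2 + k / 2 * ln (cosh \<beta>)) = ln (W s) / N"
    proof -
      have "card E / N = k / 2" using m kN by (simp add: field_simps)
      moreover have "ising_free_energy N (\<lambda>i j. A i j \<omega>) (\<lambda>_. 0)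
          = ln 2 + card E / N * ln (cosh \<beta>) + ln (W s) / N"
        unfolding W_def by (rule ising_free_energy_signs[OF sg s kN(2) eq])
      ultimately show ?thesis by (simp only: add_diff_cancel_left')
    qed
    ultimately show "\<bar>ising_free_energy N (\<lambda>i j. A i j \<omega>) (\<lambda>_. 0) - (ln 2 + k / 2 * ln (cosh \<beta>))\<bar>
        \<le> (ln 2 + 2 * r) / N"
      by (simp add: divide_right_mono)
  qed
  ultimately show ?thesis by blast
qed

section \<open>Almost sure convergence\<close>

text \<open>
  The denominators are eventually at least 1.
\<close>
lemma girth_tends_to_infinity:
  assumes "((\<lambda>N. ereal_of_enat (girth (G N)) / ereal ((ln (ln (real N)))\<^sup>2)) \<longlongrightarrow> \<infinity>) (along_admissible k)"
  shows "\<forall>\<^sub>F N in along_admissible k. \<forall>vs. is_cycle (G N) vs \<longrightarrow> g \<le> length vs"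
proof -
  have "\<forall>\<^sub>F N in along_admissible k. ereal (real g) < ereal_of_enat (girth (G N)) / ereal ((ln (ln (real N)))\<^sup>2)"
    using assms by (rule order_tendstoD) simp
  moreover have "\<forall>\<^sub>F N in sequentially. 1 \<le> (ln (ln (real N)))\<^sup>2" by real_asymp
  then have "\<forall>\<^sub>F N in along_admissible k. 1 \<le> (ln (ln (real N)))\<^sup>2"
    unfolding along_admissible_def by (auto intro: filter_leD[OF inf_le1])
  ultimately show ?thesis
  proof eventually_elim
    case (elim N)
    have nonzero: "ln (ln (real N)) \<noteq> 0" using elim(2) by auto
    show ?case
    proof (intro allI impI)
      fix vs assume vs: "is_cycle (G N) vs"
      have "girth (G N) \<le> enat (length vs)" unfolding girth_def by (rule INF_lower) (use vs in simp)
      then have "ereal_of_enat (girth (G N)) \<le> ereal (length vs)"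
        by (metis ereal_of_enat_le_iff ereal_of_enat_simps(1))
      then have "ereal_of_enat (girth (G N)) / ereal ((ln (ln (real N)))\<^sup>2) \<le> ereal (length vs) / ereal ((ln (ln (real N)))\<^sup>2)"
        using elim by (intro ereal_divide_right_mono) auto
      also have "\<dots> = ereal (length vs / (ln (ln (real N)))\<^sup>2)"
        using nonzero by simp
      also have "\<dots> \<le> ereal (length vs)"
        using divide_left_mono[OF elim(2), of "length vs"] elim(2) nonzero by simp
      finally have "ereal (real g) < ereal (length vs)" using elim by (meson less_le_trans)
      then show "g \<le> length vs" by simp
    qed
  qed
qed

theorem mainTheorem2:
  fixes k :: nat and \<beta> :: real
    and G :: "nat \<Rightarrow> nat set set"
    and M :: "'a measure"
    and A :: "nat \<Rightarrow> nat \<Rightarrow> nat \<Rightarrow> 'a \<Rightarrow> real"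
  assumes "3 \<le> k"
    and "\<bar>\<beta>\<bar> < 1 / (4 * sqrt (real k - 1))"
    and "\<And>N. N \<in> admissible_sizes k \<Longrightarrow> regular_graph k N (G N)"
    and "((\<lambda>N. ereal_of_enat (girth (G N)) / ereal ((ln (ln (real N)))\<^sup>2)) \<longlongrightarrow> \<infinity>) (along_admissible k)"
    and "prob_space M"
    and "\<And>N. N \<in> admissible_sizes k \<Longrightarrow> random_sign_weights M \<beta> N (G N) (A N)"
  shows "AE \<omega> in M.
           ((\<lambda>N. ising_free_energy N (\<lambda>i j. A N i j \<omega>) (\<lambda>_. 0))
              \<longlongrightarrow> ln 2 + real k / 2 * ln (cosh \<beta>)) (along_admissible k)"
proof -
  interpret prob_space M by fact
  define F where "F = (\<lambda>\<omega> N. ising_free_energy N (\<lambda>i j. A N i j \<omega>) (\<lambda>_. 0))"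
  define L where "L = ln 2 + real k / 2 * ln (cosh \<beta>)"
  have k: "3 \<le> real k" using assms(1) by simp
  have "\<bar>\<beta>\<bar>\<^sup>2 < (1 / (4 * sqrt (real k - 1)))\<^sup>2"
    using assms(2) by (intro power_strict_mono) auto
  then have \<beta>2: "\<beta>\<^sup>2 * (16 * (real k - 1)) < 1"
    using k by (simp add: power_mult_distrib power_divide field_simps)
  have "\<beta>\<^sup>2 * (2 * real k) \<le> \<beta>\<^sup>2 * (16 * (real k - 1))" using k by (intro mult_left_mono) auto
  then have \<beta>k: "\<beta>\<^sup>2 * k \<le> 1 / 2" using \<beta>2 by simp
  have "\<beta>\<^sup>2 * 1 \<le> \<beta>\<^sup>2 * (16 * (real k - 1))" using k by (intro mult_left_mono) auto
  then have \<beta>1: "\<bar>\<beta>\<bar> \<le> 1" using \<beta>2 by (simp add: abs_square_le_1[symmetric])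
  have key: "AE \<omega> in M. \<forall>\<^sub>F N in along_admissible k. \<bar>F \<omega> N - L\<bar> < 3 * \<eta>" if \<eta>: "0 < \<eta>" for \<eta>
  proof -
    define c where "c = \<eta>\<^sup>2 / k"
    have c: "0 < c" using \<eta> k by (simp add: c_def)
    define good where "good N B \<longleftrightarrow> B \<in> sets M \<and> measure M B \<le> exp (- (\<eta> * N)) + exp (- (c * N)) \<and>
      (AE \<omega> in M. \<omega> \<notin> B \<longrightarrow> \<bar>F \<omega> N - L\<bar> < 3 * \<eta>)" for N B
    \<comment> \<open>A girth bound \<open>g\<close> that makes the second moment at most \<open>exp (c N / 2)\<close>, against
      concentration of order \<open>exp (- c N)\<close>.\<close>
    have "(\<lambda>g. 2 * (1 / 2) ^ (g - 1) :: real) \<longlonglongrightarrow> 0" by real_asymp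
    then have "\<forall>\<^sub>F g in sequentially. 2 * (1 / 2) ^ (g - 1) < c / 2"
      by (rule order_tendstoD(2)) (use c in simp)
    then obtain g where g: "2 * (1 / 2) ^ (g - 1) < c / 2" by (auto simp: eventually_sequentially)
    have "\<forall>\<^sub>F N in sequentially. exp (- (c / 2) * real N) < 1 / 4" using c by real_asymp
    moreover have "\<forall>\<^sub>F N in sequentially. ln 2 < \<eta> * real N" using \<eta> by real_asymp
    moreover have "\<forall>\<^sub>F N in sequentially. N \<in> admissible_sizes k \<longrightarrow>
        (\<forall>vs. is_cycle (G N) vs \<longrightarrow> g \<le> length vs)"
      using girth_tends_to_infinity[OF assms(4), of g]
      by (simp add: along_admissible_def eventually_inf_principal)
    ultimately have "\<forall>\<^sub>F N in sequentially. N \<in> admissible_sizes k \<longrightarrow> (\<exists>B. good N B)"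
    proof eventually_elim
      case (elim N)
      show ?case
      proof
        assume N: "N \<in> admissible_sizes k"
        then have N0: "0 < N" by (auto simp: admissible_sizes_def)
        have r: "(\<eta> * N)\<^sup>2 / (real k * real N) = c * N"
          using N0 by (simp add: c_def power2_eq_square)
        then have r': "- (c * N) = - (\<eta> * N)\<^sup>2 / (real k * real N)" by (simp only: minus_divide_left)
        have "N * (2 * (1 / 2) ^ (g - 1)) \<le> N * (c / 2)" using g by (intro mult_left_mono) auto
        then have "exp (2 * real N * (1 / 2) ^ (g - 1) - c * N) \<le> exp (- (c / 2) * real N)"
          by (simp add: mult_ac)
        then have small: "exp (2 * real N * (1 / 2) ^ (g - 1) - c * N) < 1 / 4"
          using elim(1) by (rule le_less_trans)
        have "\<exists>B\<in>sets M. measure M B \<le> exp (- (\<eta> * N)) + exp (- (c * N)) \<and>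
            (AE \<omega> in M. \<omega> \<notin> B \<longrightarrow> \<bar>F \<omega> N - L\<bar> \<le> (ln 2 + 2 * (\<eta> * N)) / N)"
          unfolding F_def L_def r'
        proof (rule free_energy_deviation_set[OF assms(5) assms(3)[OF N] _ N0 assms(6)[OF N] \<beta>1 \<beta>k])
          show "0 < k" "0 < \<eta> * N" using k \<eta> N0 by auto
          show "g \<le> length vs" if "is_cycle (G N) vs" for vs using elim(3) N that by blast
          show "exp (2 * real N * (1 / 2) ^ (g - 1) - (\<eta> * N)\<^sup>2 / (real k * real N)) < 1 / 4"
            using small unfolding r .
        qed
        then obtain B where B: "B \<in> sets M" "measure M B \<le> exp (- (\<eta> * N)) + exp (- (c * N))"
          and dev: "AE \<omega> in M. \<omega> \<notin> B \<longrightarrow> \<bar>F \<omega> N - L\<bar> \<le> (ln 2 + 2 * (\<eta> * N)) / N"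
          by blast
        have "(ln 2 + 2 * (\<eta> * N)) / N < 3 * \<eta>"
          using elim(2) N0 by (simp add: divide_less_eq)
        then have "AE \<omega> in M. \<omega> \<notin> B \<longrightarrow> \<bar>F \<omega> N - L\<bar> < 3 * \<eta>"
          using dev by (auto elim!: eventually_mono)
        then show "\<exists>B. good N B" using B by (auto simp: good_def)
      qed
    qed
    then obtain N0 where "\<forall>N. \<exists>B. N0 \<le> N \<and> N \<in> admissible_sizes k \<longrightarrow> good N B"
      unfolding eventually_sequentially by blast
    from choice[OF this] obtain B where
      B: "\<And>N. N0 \<le> N \<Longrightarrow> N \<in> admissible_sizes k \<Longrightarrow> good N (B N)" by blast
    define D where "D N = (if N0 \<le> N \<and> N \<in> admissible_sizes k then B N else {})" for N
    have geometric: "summable (\<lambda>N. exp (- (a * real N)))" if "0 < a" for a :: real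
    proof -
      have "summable (\<lambda>N. exp (- a) ^ N)" using that by (intro summable_geometric) simp
      then show ?thesis by (simp add: exp_of_nat_mult[symmetric] mult.commute)
    qed
    have "summable (\<lambda>N. measure M (D N))"
    proof (rule summable_comparison_test)
      show "summable (\<lambda>N. exp (- (\<eta> * real N)) + exp (- (c * real N)))"
        using \<eta> c by (intro summable_add geometric)
      show "\<exists>N0. \<forall>N\<ge>N0. norm (measure M (D N)) \<le> exp (- (\<eta> * real N)) + exp (- (c * real N))"
        using B by (auto simp: D_def good_def)
    qed
    then have "AE \<omega> in M. \<forall>\<^sub>F N in sequentially. \<omega> \<in> space M - D N"
      using B by (intro borel_cantelli_AE1) (auto simp: D_def good_def emeasure_eq_measure)
    moreover have "AE \<omega> in M. \<forall>N. N0 \<le> N \<and> N \<in> admissible_sizes k \<longrightarrow>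
        \<omega> \<notin> D N \<longrightarrow> \<bar>F \<omega> N - L\<bar> < 3 * \<eta>"
      unfolding AE_all_countable using B by (auto simp: D_def good_def)
    ultimately show ?thesis
    proof eventually_elim
      case (elim \<omega>)
      have "\<forall>\<^sub>F N in sequentially. N0 \<le> N" by (rule eventually_ge_at_top)
      with elim(1) show ?case
        unfolding along_admissible_def eventually_inf_principal
        by eventually_elim (use elim(2) in auto)
    qed
  qed
  have "AE \<omega> in M. \<forall>n. \<forall>\<^sub>F N in along_admissible k. \<bar>F \<omega> N - L\<bar> < 3 * inverse (Suc n)"
    unfolding AE_all_countable by (intro allI key) simp
  then have "AE \<omega> in M. (F \<omega> \<longlongrightarrow> L) (along_admissible k)"
  proof eventually_elim
    case (elim \<omega>)
    show ?case
    proof (rule tendstoI)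
      fix e :: real assume "0 < e"
      then obtain n where "inverse (Suc n) < e / 3" using reals_Archimedean[of "e / 3"] by auto
      then have "3 * inverse (Suc n) < e" by simp
      with elim[rule_format, of n] show "\<forall>\<^sub>F N in along_admissible k. dist (F \<omega> N) L < e"
        by (auto elim!: eventually_mono simp: dist_real_def)
    qed
  qed
  then show ?thesis by (simp only: F_def L_def)
qed

end
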